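(* Let $(X,\mu,\mathcal{E},\mathcal{F})$ be a Dirichlet space with conservative heat semigroup $\{P_t\}_{t\in[0,\infty)}$. Let $1<p\le2$. There exists a constant $C_p>0$ such that for every $f\in L^p(X,\mu)$ and $t>0$, $$\|P_tf\|_{p,1/2}\le\frac{C_p}{t^{1/2}}\|f\|_{L^p(X,\mu)}.$$ In particular $P_t:L^p(X,\mu)\to\mathbf B^{p,1/2}(X)$ is bounded for $t>0$.
   Context: $X$ is a good measurable space (the measure decomposition theorem holds and the $\sigma$-algebra is generated by a countable family; e.g. a Polish space) with a $\sigma$-finite measure $\mu$. A Dirichlet form is a densely defined closed symmetric form $(\mathcal{E},\mathcal{F})$ on $L^2(X,\mu)$ which is Markovian: if $u\in\mathcal F$ and $v$ satisfies $|v(x)-v(y)|\le|u(x)-u(y)|$ and $|v(x)|\le|u(x)|$ for a.e. $x,y$, then $v\in\mathcal F$ and $\mathcal E(v,v)\le\mathcal E(u,u)$. Then $(X,\mu,\mathcal E,\mathcal F)$ is called a Dirichlet space. $\{P_t\}_{t\ge0}$ is the associated self-adjoint sub-Markovian semigroup on $L^2(X,\mu)$ (the heat semigroup), extended to a contraction semigroup on every $L^p(X,\mu)$, $1\le p\le\infty$. It is conservative if $P_t1=1$ for all $t$; then there are probability kernels $p_t(x,dy)$ with $P_tf(x)=\int_Xf(y)\,p_t(x,dy)$ for bounded or non-negative measurable $f$. For $p\ge1$, $\alpha\ge0$, $f\in L^p(X,\mu)$, $$\|f\|_{p,\alpha}=\sup_{t>0}t^{-\alpha}\left(\int_X\int_X|f(x)-f(y)|^p\,p_t(y,dx)\,d\mu(y)\right)^{1/p},$$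 $\mathbf B^{p,\alpha}(X)=\{f\in L^p(X,\mu):\|f\|_{p,\alpha}<+\infty\}$, normed by $\|f\|_{L^p(X,\mu)}+\|f\|_{p,\alpha}$. *)

theory Defs
  imports "HOL-Probability.Probability"
begin

text \<open>
  Elements of the Lebesgue spaces are represented by measurable real-valued functions; all
  identities between them are required to hold almost everywhere only.
\<close>

definition Lp_space :: "'a measure \<Rightarrow> real \<Rightarrow> ('a \<Rightarrow> real) set" where
  "Lp_space M p = {f \<in> borel_measurable M. integrable M (\<lambda>x. \<bar>f x\<bar> powr p)}"

definition Lp_norm :: "'a measure \<Rightarrow> real \<Rightarrow> ('a \<Rightarrow> real) \<Rightarrow> real" where
  "Lp_norm M p f = (LINT x|M. \<bar>f x\<bar> powr p) powr (1 / p)"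

definition Linf_space :: "'a measure \<Rightarrow> ('a \<Rightarrow> real) set" where
  "Linf_space M = {f \<in> borel_measurable M. \<exists>c. AE x in M. \<bar>f x\<bar> \<le> c}"

definition Linf_norm :: "'a measure \<Rightarrow> ('a \<Rightarrow> real) \<Rightarrow> real" where
  "Linf_norm M f = Inf {c. 0 \<le> c \<and> (AE x in M. \<bar>f x\<bar> \<le> c)}"

definition L2_inner :: "'a measure \<Rightarrow> ('a \<Rightarrow> real) \<Rightarrow> ('a \<Rightarrow> real) \<Rightarrow> real" where
  "L2_inner M f g = (LINT x|M. f x * g x)"

definition countably_generated :: "'a measure \<Rightarrow> bool" where
  "countably_generated M \<longleftrightarrow>
     (\<exists>G. countable G \<and> G \<subseteq> Pow (space M) \<and> sets M = sigma_sets (space M) G)"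

text \<open>
  The measure decomposition theorem on \<open>X \<times> X\<close>: every probability measure \<open>\<nu>\<close> can be written
  as \<open>\<nu>(dx, dy) = \<kappa>(x, dy) \<nu>\<^sub>1(dx)\<close>, where \<open>\<nu>\<^sub>1\<close> is the first marginal and \<open>\<kappa>\<close> a probability
  kernel.  Only the \<open>\<sigma>\<close>-algebra of \<open>M\<close> matters here.
\<close>

definition measure_decomposition :: "'a measure \<Rightarrow> bool" where
  "measure_decomposition M \<longleftrightarrow>
     (\<forall>\<nu>. prob_space \<nu> \<and> sets \<nu> = sets (M \<Otimes>\<^sub>M M) \<longrightarrow>
       (\<exists>\<kappa> \<in> M \<rightarrow>\<^sub>M prob_algebra M. \<forall>A \<in> sets (M \<Otimes>\<^sub>M M).
          emeasure \<nu> A = (\<integral>\<^sup>+x. (\<integral>\<^sup>+y. indicator A (x, y) \<partial>\<kappa> x) \<partial>distr \<nu> M fst)))"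

definition good_measurable_space :: "'a measure \<Rightarrow> bool" where
  "good_measurable_space M \<longleftrightarrow> countably_generated M \<and> measure_decomposition M"

locale dirichlet_space = sigma_finite_measure M
  for M :: "'a measure"
    and \<E> :: "('a \<Rightarrow> real) \<Rightarrow> ('a \<Rightarrow> real) \<Rightarrow> real"
    and \<F> :: "('a \<Rightarrow> real) set" +
  assumes good: "good_measurable_space M"
    and dom_L2: "\<F> \<subseteq> Lp_space M 2"
    and dom_cong: "u \<in> \<F> \<Longrightarrow> v \<in> borel_measurable M \<Longrightarrow> (AE x in M. v x = u x) \<Longrightarrow> v \<in> \<F>"
    and form_cong: "u \<in> \<F> \<Longrightarrow> u' \<in> \<F> \<Longrightarrow> v \<in> \<F> \<Longrightarrow> (AE x in M. u x = u' x) \<Longrightarrow> \<E> u v = \<E> u' v"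
    and dom_zero: "(\<lambda>x. 0) \<in> \<F>"
    and dom_lin: "u \<in> \<F> \<Longrightarrow> v \<in> \<F> \<Longrightarrow> (\<lambda>x. a * u x + b * v x) \<in> \<F>"
    and form_lin: "u \<in> \<F> \<Longrightarrow> v \<in> \<F> \<Longrightarrow> w \<in> \<F> \<Longrightarrow>
          \<E> (\<lambda>x. a * u x + b * v x) w = a * \<E> u w + b * \<E> v w"
    and form_sym: "u \<in> \<F> \<Longrightarrow> v \<in> \<F> \<Longrightarrow> \<E> u v = \<E> v u"
    and form_nonneg: "u \<in> \<F> \<Longrightarrow> 0 \<le> \<E> u u"
    and dom_dense: "f \<in> Lp_space M 2 \<Longrightarrow> 0 < e \<Longrightarrow>
          \<exists>u\<in>\<F>. Lp_norm M 2 (\<lambda>x. f x - u x) < e"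
    and closed:
      "\<And>u :: nat \<Rightarrow> 'a \<Rightarrow> real.
         (\<And>n. u n \<in> \<F>) \<Longrightarrow>
         (\<And>e. 0 < e \<Longrightarrow> \<exists>N. \<forall>m\<ge>N. \<forall>n\<ge>N.
            \<E> (\<lambda>x. u m x - u n x) (\<lambda>x. u m x - u n x)
              + (Lp_norm M 2 (\<lambda>x. u m x - u n x))\<^sup>2 < e) \<Longrightarrow>
         \<exists>v\<in>\<F>. (\<lambda>n. \<E> (\<lambda>x. u n x - v x) (\<lambda>x. u n x - v x)
              + (Lp_norm M 2 (\<lambda>x. u n x - v x))\<^sup>2) \<longlonglongrightarrow> 0"
    and markovian:
      "u \<in> \<F> \<Longrightarrow> v \<in> borel_measurable M \<Longrightarrow>
       (AE z in M \<Otimes>\<^sub>M M. \<bar>v (fst z) - v (snd z)\<bar> \<le> \<bar>u (fst z) - u (snd z)\<bar>) \<Longrightarrow>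
       (AE x in M. \<bar>v x\<bar> \<le> \<bar>u x\<bar>) \<Longrightarrow>
       v \<in> \<F> \<and> \<E> v v \<le> \<E> u u"

text \<open>\<open>V\<close> with seminorm \<open>N\<close> is meant to be one of the Lebesgue spaces over \<open>M\<close>.\<close>

definition contraction_semigroup_on ::
  "'a measure \<Rightarrow> ('a \<Rightarrow> real) set \<Rightarrow> (('a \<Rightarrow> real) \<Rightarrow> real) \<Rightarrow>
   (real \<Rightarrow> ('a \<Rightarrow> real) \<Rightarrow> 'a \<Rightarrow> real) \<Rightarrow> bool" where
  "contraction_semigroup_on M V N P \<longleftrightarrow>
     (\<forall>t\<ge>0. \<forall>f\<in>V. P t f \<in> V \<and> N (P t f) \<le> N f) \<and>
     (\<forall>t\<ge>0. \<forall>f\<in>V. \<forall>g\<in>V. \<forall>a b.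
        AE x in M. P t (\<lambda>y. a * f y + b * g y) x = a * P t f x + b * P t g x) \<and>
     (\<forall>f\<in>V. AE x in M. P 0 f x = f x) \<and>
     (\<forall>s\<ge>0. \<forall>t\<ge>0. \<forall>f\<in>V. AE x in M. P (s + t) f x = P s (P t f) x)"

text \<open>
  \<open>is_L2_generator_value M P f g\<close>: the function \<open>f\<close> lies in the domain of the infinitesimal
  generator \<open>L\<close> of \<open>P\<close> on \<open>L\<^sup>2\<close>, and \<open>L f = g\<close>.
\<close>

definition is_L2_generator_value ::
  "'a measure \<Rightarrow> (real \<Rightarrow> ('a \<Rightarrow> real) \<Rightarrow> 'a \<Rightarrow> real) \<Rightarrow> ('a \<Rightarrow> real) \<Rightarrow> ('a \<Rightarrow> real) \<Rightarrow> bool" where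
  "is_L2_generator_value M P f g \<longleftrightarrow>
     f \<in> Lp_space M 2 \<and> g \<in> Lp_space M 2 \<and>
     ((\<lambda>h. Lp_norm M 2 (\<lambda>x. (P h f x - f x) / h - g x)) \<longlongrightarrow> 0) (at_right 0)"

text \<open>
  The heat semigroup of a Dirichlet space.  Assumption \<open>generator\<close> says that the generator of
  \<open>P\<close> on \<open>L\<^sup>2\<close> is the self-adjoint operator associated with the form, which determines \<open>P\<close>
  on \<open>L\<^sup>2\<close> up to null sets.  The same \<open>P\<close> also denotes the extensions to the other Lebesgue
  spaces: for finite exponents these are determined by density and the contraction property,
  and on \<open>L\<^sup>\<infinity>\<close> by duality with \<open>L\<^sup>1\<close>.
\<close>

locale heat_semigroup = dirichlet_space M \<E> \<F>
  for M :: "'a measure" and \<E> \<F> +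
  fixes P :: "real \<Rightarrow> ('a \<Rightarrow> real) \<Rightarrow> 'a \<Rightarrow> real"
  assumes semigroup_Lp: "1 \<le> q \<Longrightarrow> contraction_semigroup_on M (Lp_space M q) (Lp_norm M q) P"
    and semigroup_Linf: "contraction_semigroup_on M (Linf_space M) (Linf_norm M) P"
    and strongly_continuous: "f \<in> Lp_space M 2 \<Longrightarrow>
          ((\<lambda>t. Lp_norm M 2 (\<lambda>x. P t f x - f x)) \<longlongrightarrow> 0) (at_right 0)"
    and self_adjoint: "0 \<le> t \<Longrightarrow> f \<in> Lp_space M 2 \<Longrightarrow> g \<in> Lp_space M 2 \<Longrightarrow>
          L2_inner M (P t f) g = L2_inner M f (P t g)"
    and sub_markovian: "0 \<le> t \<Longrightarrow> f \<in> Lp_space M 2 \<Longrightarrow> (AE x in M. 0 \<le> f x \<and> f x \<le> 1) \<Longrightarrow>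
          (AE x in M. 0 \<le> P t f x \<and> P t f x \<le> 1)"
    and generator: "f \<in> Lp_space M 2 \<Longrightarrow> g \<in> Lp_space M 2 \<Longrightarrow>
          is_L2_generator_value M P f g \<longleftrightarrow> f \<in> \<F> \<and> (\<forall>v\<in>\<F>. \<E> f v = - L2_inner M g v)"
    and dual_Linf: "0 \<le> t \<Longrightarrow> f \<in> Linf_space M \<Longrightarrow> g \<in> Lp_space M 1 \<Longrightarrow>
          (LINT x|M. P t f x * g x) = (LINT x|M. f x * P t g x)"

definition conservative ::
  "'a measure \<Rightarrow> (real \<Rightarrow> ('a \<Rightarrow> real) \<Rightarrow> 'a \<Rightarrow> real) \<Rightarrow> bool" where
  "conservative M P \<longleftrightarrow> (\<forall>t\<ge>0. AE x in M. P t (\<lambda>_. 1) x = 1)"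

text \<open>
  \<open>k t x\<close> is the probability measure \<open>p\<^sub>t(x, dy)\<close>.  The representation for bounded functions
  determines \<open>k t x\<close> for almost every \<open>x\<close>, and extends by monotone convergence to
  non-negative and to \<open>p\<close>-integrable functions.
\<close>

definition heat_kernel ::
  "'a measure \<Rightarrow> (real \<Rightarrow> ('a \<Rightarrow> real) \<Rightarrow> 'a \<Rightarrow> real) \<Rightarrow> (real \<Rightarrow> 'a \<Rightarrow> 'a measure) \<Rightarrow> bool" where
  "heat_kernel M P k \<longleftrightarrow>
     (\<forall>t>0. k t \<in> M \<rightarrow>\<^sub>M prob_algebra M \<and>
       (\<forall>f \<in> borel_measurable M. (\<exists>c. \<forall>x\<in>space M. \<bar>f x\<bar> \<le> c) \<longrightarrow>
          (AE x in M. P t f x = (LINT y|k t x. f y))))"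

text \<open>Real powers of extended non-negative numbers, for exponents \<open>r > 0\<close>.\<close>

definition enn_powr :: "ennreal \<Rightarrow> real \<Rightarrow> ennreal" where
  "enn_powr x r = (if x = \<infinity> then \<infinity> else ennreal (enn2real x powr r))"

definition besov_seminorm ::
  "'a measure \<Rightarrow> (real \<Rightarrow> 'a \<Rightarrow> 'a measure) \<Rightarrow> real \<Rightarrow> real \<Rightarrow> ('a \<Rightarrow> real) \<Rightarrow> ennreal" where
  "besov_seminorm M k p \<alpha> f =
     (SUP t\<in>{0<..}. ennreal (t powr (- \<alpha>)) *
        enn_powr (\<integral>\<^sup>+y. (\<integral>\<^sup>+x. ennreal (\<bar>f x - f y\<bar> powr p) \<partial>k t y) \<partial>M) (1 / p))"

definition besov_space ::
  "'a measure \<Rightarrow> (real \<Rightarrow> 'a \<Rightarrow> 'a measure) \<Rightarrow> real \<Rightarrow> real \<Rightarrow> ('a \<Rightarrow> real) set" where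
  "besov_space M k p \<alpha> = {f \<in> Lp_space M p. besov_seminorm M k p \<alpha> f < \<infinity>}"

text \<open>Meaningful on \<open>besov_space M k p \<alpha>\<close>, where the seminorm is finite.\<close>

definition besov_norm ::
  "'a measure \<Rightarrow> (real \<Rightarrow> 'a \<Rightarrow> 'a measure) \<Rightarrow> real \<Rightarrow> real \<Rightarrow> ('a \<Rightarrow> real) \<Rightarrow> real" where
  "besov_norm M k p \<alpha> f = Lp_norm M p f + enn2real (besov_seminorm M k p \<alpha> f)"

end

theory Submission
  imports Defs
begin

text \<open>
  Write \<open>D\<^sub>s = I - P\<^sub>s\<close>.  The analyticity estimate \<open>\<parallel>D\<^sub>s P\<^sub>t f\<parallel>\<^sub>p \<le> C (s/t) \<parallel>f\<parallel>\<^sub>p\<close> for \<open>s \<le> t\<close>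
  is elementary for \<open>p = 2\<close>, because \<open>t \<mapsto> \<langle>P\<^sub>t f, f\<rangle>\<close> has decreasing, non-negative second differences.
  It passes to smaller exponents by real methods instead of Stein's complex interpolation: if it
  holds for \<open>q\<close>, then \<open>D\<^sub>s\<^sup>2 P\<^sub>t\<close> has norm \<open>O((s/t)\<^sup>2)\<close> on \<open>L\<^sup>q\<close> and norm at most 4 on \<open>L\<^sup>1\<close>,
  so it has norm \<open>O((s/t)\<^bsup>3/2\<^esup>)\<close> on \<open>L\<^sup>p\<close> for \<open>p < q\<close> close to \<open>q\<close> by Marcinkiewicz interpolation; since
  the order \<open>3/2\<close> exceeds 1, iterating \<open>D\<^sub>s = (D\<^bsub>2s\<^esub> + D\<^sub>s\<^sup>2) / 2\<close> as in Marchaud's inequality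
  gives the first order estimate on \<open>L\<^sup>p\<close>.

  For \<open>u = P\<^sub>t f\<close> and \<open>\<phi> x = sgn x \<bar>x\<bar>\<^bsup>p-1\<^esup>\<close>, a pointwise inequality bounds \<open>\<bar>u x - u y\<bar>\<^sup>p\<close> by
  \<open>\<epsilon>\<^bsup>p/2-1\<^esup> (u x - u y) (\<phi> (u x) - \<phi> (u y))\<close> and \<open>\<epsilon>\<^bsup>p/2\<^esup> (\<bar>u x\<bar>\<^sup>p + \<bar>u y\<bar>\<^sup>p)\<close>, up to constants.
  Integrated against the symmetric measure \<open>p\<^sub>s(y, dx) \<mu>(dy)\<close> with \<open>\<epsilon> = s/t\<close>, the first term becomes
  \<open>2 \<integral> D\<^sub>s u \<phi>(u) d\<mu>\<close>, which the analyticity estimate controls.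
\<close>

section \<open>Lebesgue spaces\<close>

lemma Lp_spaceD:
  assumes "f \<in> Lp_space M q"
  shows "f \<in> borel_measurable M" "integrable M (\<lambda>x. \<bar>f x\<bar> powr q)"
  using assms by (auto simp: Lp_space_def)

lemma Lp_space_measurable [measurable_dest]: "f \<in> Lp_space M q \<Longrightarrow> f \<in> borel_measurable M"
  by (simp add: Lp_space_def)

lemma Lp_norm_nonneg [simp]: "0 \<le> Lp_norm M q f"
  by (simp add: Lp_norm_def)

lemma Lp_norm_powr:
  assumes "0 < q"
  shows "Lp_norm M q f powr q = (LINT x|M. \<bar>f x\<bar> powr q)"
  using assms by (simp add: Lp_norm_def powr_powr)

lemma Lp_norm_le_iff:
  assumes "0 < q" "0 \<le> c"
  shows "Lp_norm M q f \<le> c \<longleftrightarrow> (LINT x|M. \<bar>f x\<bar> powr q) \<le> c powr q"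
proof -
  have "Lp_norm M q f \<le> c \<longleftrightarrow> Lp_norm M q f powr q \<le> c powr q"
    using assms by (metis Lp_norm_nonneg linorder_not_less powr_less_mono2 powr_mono2 less_imp_le)
  then show ?thesis
    using assms by (simp add: Lp_norm_powr)
qed

lemma Lp_norm_cong_AE:
  assumes "f \<in> borel_measurable M" "g \<in> borel_measurable M" "AE x in M. g x = f x"
  shows "Lp_norm M q g = Lp_norm M q f"
proof -
  have "(LINT x|M. \<bar>g x\<bar> powr q) = (LINT x|M. \<bar>f x\<bar> powr q)"
    using assms(3) by (intro integral_cong_AE) (use assms in auto)
  then show ?thesis
    by (simp add: Lp_norm_def)
qed

lemma Lp_norm_zero_iff_AE:
  assumes "f \<in> Lp_space M q" "0 < q"
  shows "Lp_norm M q f = 0 \<longleftrightarrow> (AE x in M. f x = 0)"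
proof -
  have "Lp_norm M q f = 0 \<longleftrightarrow> (LINT x|M. \<bar>f x\<bar> powr q) = 0"
    using assms(2) by (simp add: Lp_norm_def)
  also have "\<dots> \<longleftrightarrow> (AE x in M. \<bar>f x\<bar> powr q = 0)"
    using assms by (intro integral_nonneg_eq_0_iff_AE) (auto simp: Lp_space_def)
  finally show ?thesis
    by simp
qed

lemma Lp_scale:
  assumes "f \<in> Lp_space M q" "0 < q"
  shows "(\<lambda>x. a * f x) \<in> Lp_space M q" "Lp_norm M q (\<lambda>x. a * f x) = \<bar>a\<bar> * Lp_norm M q f"
proof -
  show "(\<lambda>x. a * f x) \<in> Lp_space M q"
    using assms by (auto simp: Lp_space_def abs_mult powr_mult)
  have "Lp_norm M q (\<lambda>x. a * f x) = (\<bar>a\<bar> powr q * (LINT x|M. \<bar>f x\<bar> powr q)) powr (1 / q)"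
    by (simp add: Lp_norm_def abs_mult powr_mult)
  then show "Lp_norm M q (\<lambda>x. a * f x) = \<bar>a\<bar> * Lp_norm M q f"
    using assms by (simp add: Lp_norm_def powr_mult powr_powr)
qed

text \<open>Convexity of the q-th power at |x| / l and |y| / (1 - l), with weights l and 1 - l. The
  weight stays free: 1/2 suffices for membership of sums, while Minkowski's inequality takes the
  optimal weight.\<close>

lemma abs_add_powr_le:
  fixes x y q l :: real
  assumes q: "1 \<le> q" and l: "0 < l" "l < 1"
  shows "\<bar>x + y\<bar> powr q \<le> l powr (1 - q) * \<bar>x\<bar> powr q + (1 - l) powr (1 - q) * \<bar>y\<bar> powr q"
proof -
  have one: "1 \<le> u powr (1 - q)" if "0 < u" "u < 1" for u :: real
    using powr_mono'[of "1 - q" 0 u] that q by simp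
  have mono: "\<bar>x + y\<bar> powr q \<le> (\<bar>x\<bar> + \<bar>y\<bar>) powr q"
    using q by (intro powr_mono2) auto
  consider "x = 0" | "y = 0" | "x \<noteq> 0" "y \<noteq> 0"
    by blast
  then show ?thesis
  proof cases
    case 1
    then show ?thesis
      using mult_right_mono[OF one[of "1 - l"], of "\<bar>y\<bar> powr q"] l by simp
  next
    case 2
    then show ?thesis
      using mult_right_mono[OF one[of l], of "\<bar>x\<bar> powr q"] l by simp
  next
    case 3
    have "(l * (\<bar>x\<bar> / l) + (1 - l) * (\<bar>y\<bar> / (1 - l))) powr q
        \<le> l * (\<bar>x\<bar> / l) powr q + (1 - l) * (\<bar>y\<bar> / (1 - l)) powr q"
      using convex_onD[OF powr_convex[OF q], of "1 - l" "\<bar>x\<bar> / l" "\<bar>y\<bar> / (1 - l)"] l 3 by simp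
    moreover have "l * (\<bar>x\<bar> / l) powr q = l powr (1 - q) * \<bar>x\<bar> powr q"
      using l by (simp add: powr_divide powr_diff)
    moreover have "(1 - l) * (\<bar>y\<bar> / (1 - l)) powr q = (1 - l) powr (1 - q) * \<bar>y\<bar> powr q"
      using l by (simp add: powr_divide powr_diff)
    ultimately show ?thesis
      using l mono by simp
  qed
qed

lemma Lp_add_space:
  assumes "f \<in> Lp_space M q" "g \<in> Lp_space M q" "1 \<le> q"
  shows "(\<lambda>x. f x + g x) \<in> Lp_space M q"
proof -
  note [measurable] = Lp_spaceD(1)[OF assms(1)] Lp_spaceD(1)[OF assms(2)]
  have "integrable M (\<lambda>x. \<bar>f x + g x\<bar> powr q)"
  proof (rule Bochner_Integration.integrable_bound)
    show "integrable M (\<lambda>x. (1/2) powr (1 - q) * \<bar>f x\<bar> powr q + (1/2) powr (1 - q) * \<bar>g x\<bar> powr q)"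
      using assms by (auto simp: Lp_space_def)
    show "AE x in M. norm (\<bar>f x + g x\<bar> powr q)
        \<le> norm ((1/2) powr (1 - q) * \<bar>f x\<bar> powr q + (1/2) powr (1 - q) * \<bar>g x\<bar> powr q)"
      using abs_add_powr_le[OF assms(3), of "1/2"] by (intro AE_I2) (simp)
  qed simp
  then show ?thesis
    by (simp add: Lp_space_def)
qed

lemma Lp_norm_triangle:
  assumes f: "f \<in> Lp_space M q" and g: "g \<in> Lp_space M q" and q: "1 \<le> q"
  shows "Lp_norm M q (\<lambda>x. f x + g x) \<le> Lp_norm M q f + Lp_norm M q g"
proof (rule field_le_epsilon)
  fix e :: real
  assume "0 < e"
  define a where "a = Lp_norm M q f + e / 2"
  define b where "b = Lp_norm M q g + e / 2"
  \<comment> \<open>With this weight the two terms add up to exactly \<open>(a + b) powr q\<close>.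
    The slack e / 2 in \<open>a\<close> and \<open>b\<close> keeps both positive, so 0 < l < 1 even
    if a norm vanishes.\<close>
  define l where "l = a / (a + b)"
  have ab: "0 < a" "0 < b"
    using \<open>0 < e\<close> unfolding a_def b_def by (auto intro: add_nonneg_pos)
  then have l: "0 < l" "l < 1" and l': "1 - l = b / (a + b)"
    by (auto simp: l_def field_simps)
  have ia: "(LINT x|M. \<bar>f x\<bar> powr q) \<le> a powr q" and ib: "(LINT x|M. \<bar>g x\<bar> powr q) \<le> b powr q"
    using Lp_norm_le_iff[of q a M f] Lp_norm_le_iff[of q b M g] q ab \<open>0 < e\<close>
    by (auto simp: a_def b_def)
  have "(LINT x|M. \<bar>f x + g x\<bar> powr q)
      \<le> (LINT x|M. l powr (1 - q) * \<bar>f x\<bar> powr q + (1 - l) powr (1 - q) * \<bar>g x\<bar> powr q)"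
    using f g Lp_add_space[OF f g q] abs_add_powr_le[OF q l]
    by (intro integral_mono) (auto simp: Lp_space_def)
  also have "\<dots> = l powr (1 - q) * (LINT x|M. \<bar>f x\<bar> powr q)
      + (1 - l) powr (1 - q) * (LINT x|M. \<bar>g x\<bar> powr q)"
    using f g by (auto simp: Lp_space_def)
  also have "\<dots> \<le> l powr (1 - q) * a powr q + (1 - l) powr (1 - q) * b powr q"
    using ia ib by (intro add_mono mult_left_mono) auto
  also have "\<dots> = (a + b) powr q"
  proof -
    have *: "(c / (a + b)) powr (1 - q) * c powr q = c * (a + b) powr (q - 1)" if "0 < c" for c
    proof -
      have "(c / (a + b)) powr (1 - q) * c powr q = (c powr (1 - q) * c powr q) / (a + b) powr (1 - q)"
        using that ab by (simp add: powr_divide)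
      also have "\<dots> = c * (a + b) powr (q - 1)"
        using that ab powr_minus_divide[of "a + b" "1 - q"] by (simp flip: powr_add)
      finally show ?thesis .
    qed
    have "l powr (1 - q) * a powr q + (1 - l) powr (1 - q) * b powr q = (a + b) powr 1 * (a + b) powr (q - 1)"
      using ab unfolding l' unfolding l_def by (simp add: * distrib_right)
    then show ?thesis
      unfolding powr_add[symmetric] by simp
  qed
  finally have "Lp_norm M q (\<lambda>x. f x + g x) \<le> a + b"
    using q ab by (subst Lp_norm_le_iff) auto
  then show "Lp_norm M q (\<lambda>x. f x + g x) \<le> Lp_norm M q f + Lp_norm M q g + e"
    by (simp add: a_def b_def)
qed

lemma Lp_lincomb:
  assumes "f \<in> Lp_space M q" "g \<in> Lp_space M q" "1 \<le> q"
  shows "(\<lambda>x. a * f x + b * g x) \<in> Lp_space M q"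
    and "Lp_norm M q (\<lambda>x. a * f x + b * g x) \<le> \<bar>a\<bar> * Lp_norm M q f + \<bar>b\<bar> * Lp_norm M q g"
proof -
  have q: "0 < q"
    using assms(3) by simp
  show "(\<lambda>x. a * f x + b * g x) \<in> Lp_space M q"
    using assms q by (intro Lp_add_space Lp_scale)
  show "Lp_norm M q (\<lambda>x. a * f x + b * g x) \<le> \<bar>a\<bar> * Lp_norm M q f + \<bar>b\<bar> * Lp_norm M q g"
    using Lp_norm_triangle[OF Lp_scale(1)[OF assms(1) q, of a] Lp_scale(1)[OF assms(2) q, of b] assms(3)]
      Lp_scale(2)[OF assms(1) q] Lp_scale(2)[OF assms(2) q] by simp
qed

lemma Lp_diff:
  assumes "f \<in> Lp_space M q" "g \<in> Lp_space M q" "1 \<le> q"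
  shows "(\<lambda>x. f x - g x) \<in> Lp_space M q"
    and "Lp_norm M q (\<lambda>x. f x - g x) \<le> Lp_norm M q f + Lp_norm M q g"
  using Lp_lincomb[OF assms, of 1 "-1"] by simp_all

section \<open>The inner product of L^2\<close>

lemma Lp_norm_2: "(Lp_norm M 2 f)\<^sup>2 = L2_inner M f f"
  by (simp add: Lp_norm_def L2_inner_def powr_half_sqrt power2_eq_square[symmetric])

lemma L2_integrable_mult:
  assumes "f \<in> Lp_space M 2" "g \<in> Lp_space M 2"
  shows "integrable M (\<lambda>x. f x * g x)"
proof -
  note [measurable] = Lp_spaceD(1)[OF assms(1)] Lp_spaceD(1)[OF assms(2)]
  have "integrable M (\<lambda>x. (f x)\<^sup>2 + (g x)\<^sup>2)"
    using assms by (auto simp: Lp_space_def)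
  then show ?thesis
  proof (rule Bochner_Integration.integrable_bound)
    show "AE x in M. norm (f x * g x) \<le> norm ((f x)\<^sup>2 + (g x)\<^sup>2)"
    proof (intro AE_I2)
      fix x
      show "norm (f x * g x) \<le> norm ((f x)\<^sup>2 + (g x)\<^sup>2)"
        using sum_squares_bound[of "\<bar>f x\<bar>" "\<bar>g x\<bar>"] abs_ge_zero[of "f x * g x"]
        unfolding real_norm_def abs_mult power2_abs by linarith
    qed
  qed simp
qed

lemma L2_inner_commute: "L2_inner M f g = L2_inner M g f"
  by (simp add: L2_inner_def mult.commute)

lemma L2_inner_diff_left:
  assumes "f \<in> Lp_space M 2" "g \<in> Lp_space M 2" "h \<in> Lp_space M 2"
  shows "L2_inner M (\<lambda>x. f x - g x) h = L2_inner M f h - L2_inner M g h"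
  using assms by (simp add: L2_inner_def left_diff_distrib L2_integrable_mult)

lemma L2_inner_cong_AE:
  assumes "f \<in> Lp_space M 2" "f' \<in> Lp_space M 2" "g \<in> Lp_space M 2" "AE x in M. f x = f' x"
  shows "L2_inner M f g = L2_inner M f' g"
  unfolding L2_inner_def
  using assms(4) by (intro integral_cong_AE) (use assms(1-3) in \<open>auto simp: Lp_space_def\<close>)

section \<open>Analyticity of the heat semigroup\<close>

definition heat_diff :: "(real \<Rightarrow> ('a \<Rightarrow> real) \<Rightarrow> 'a \<Rightarrow> real) \<Rightarrow> real \<Rightarrow> ('a \<Rightarrow> real) \<Rightarrow> 'a \<Rightarrow> real" where
  "heat_diff P s f = (\<lambda>x. f x - P s f x)"

context heat_semigroup
begin

abbreviation "D \<equiv> heat_diff P"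

section \<open>Algebra of the semigroup and its differences modulo null sets\<close>

lemma P_Lp:
  assumes "1 \<le> q" "0 \<le> t" "f \<in> Lp_space M q"
  shows "P t f \<in> Lp_space M q" "Lp_norm M q (P t f) \<le> Lp_norm M q f"
  using semigroup_Lp[OF assms(1)] assms by (auto simp: contraction_semigroup_on_def)

lemma P_lincomb:
  assumes "1 \<le> q" "0 \<le> t" "f \<in> Lp_space M q" "g \<in> Lp_space M q"
  shows "AE x in M. P t (\<lambda>y. a * f y + b * g y) x = a * P t f x + b * P t g x"
  using semigroup_Lp[OF assms(1)] assms by (auto simp: contraction_semigroup_on_def)

lemma P_add:
  assumes "1 \<le> q" "0 \<le> s" "0 \<le> t" "f \<in> Lp_space M q"
  shows "AE x in M. P (s + t) f x = P s (P t f) x"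
  using semigroup_Lp[OF assms(1)] assms by (auto simp: contraction_semigroup_on_def)

lemma P_0:
  assumes "1 \<le> q" "f \<in> Lp_space M q"
  shows "AE x in M. P 0 f x = f x"
  using semigroup_Lp[OF assms(1)] assms by (auto simp: contraction_semigroup_on_def)

lemma P_diff:
  assumes "1 \<le> q" "0 \<le> t" "f \<in> Lp_space M q" "g \<in> Lp_space M q"
  shows "AE x in M. P t (\<lambda>y. f y - g y) x = P t f x - P t g x"
  using P_lincomb[OF assms, of 1 "-1"] by simp

text \<open>\<open>P\<close> acts on functions rather than on classes. Linearity reduces the claim
  to f - g, which has norm 0, and contraction hands this norm on to its image.\<close>

lemma P_cong_AE:
  assumes "1 \<le> q" "0 \<le> t" "f \<in> Lp_space M q" "g \<in> Lp_space M q" "AE x in M. f x = g x"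
  shows "AE x in M. P t f x = P t g x"
proof -
  let ?h = "\<lambda>x. f x - g x"
  have h: "?h \<in> Lp_space M q"
    using assms by (intro Lp_diff)
  have "Lp_norm M q ?h = 0"
    using assms(1,5) by (subst Lp_norm_zero_iff_AE[OF h]) auto
  then have "Lp_norm M q (P t ?h) = 0"
    using P_Lp(2)[OF assms(1,2) h] Lp_norm_nonneg[of M q "P t ?h"] by simp
  then have "AE x in M. P t ?h x = 0"
    using P_Lp(1)[OF assms(1,2) h] assms(1) by (subst (asm) Lp_norm_zero_iff_AE) auto
  then show ?thesis
    using P_diff[OF assms(1-4)] by eventually_elim simp
qed

lemma D_Lp:
  assumes "1 \<le> q" "0 \<le> s" "f \<in> Lp_space M q"
  shows "D s f \<in> Lp_space M q" "Lp_norm M q (D s f) \<le> 2 * Lp_norm M q f"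
proof -
  show "D s f \<in> Lp_space M q"
    unfolding heat_diff_def using assms by (intro Lp_diff P_Lp)
  have "Lp_norm M q (D s f) \<le> Lp_norm M q f + Lp_norm M q (P s f)"
    unfolding heat_diff_def using assms by (intro Lp_diff P_Lp)
  then show "Lp_norm M q (D s f) \<le> 2 * Lp_norm M q f"
    using P_Lp(2)[OF assms] by simp
qed

lemma D_cong_AE:
  assumes "1 \<le> q" "0 \<le> s" "f \<in> Lp_space M q" "g \<in> Lp_space M q" "AE x in M. f x = g x"
  shows "AE x in M. D s f x = D s g x"
  using P_cong_AE[OF assms] assms(5) unfolding heat_diff_def by eventually_elim simp

lemma P_commute:
  assumes "1 \<le> q" "0 \<le> s" "0 \<le> t" "f \<in> Lp_space M q"
  shows "AE x in M. P s (P t f) x = P t (P s f) x"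
  using P_add[OF assms] P_add[OF assms(1,3,2,4)] unfolding add.commute[of t s]
  by eventually_elim simp

lemma P_D_commute:
  assumes "1 \<le> q" "0 \<le> s" "0 \<le> t" "f \<in> Lp_space M q"
  shows "AE x in M. P t (D s f) x = D s (P t f) x"
  using P_diff[OF assms(1,3,4) P_Lp(1)[OF assms(1,2,4)]] P_commute[OF assms]
  unfolding heat_diff_def by eventually_elim simp

text \<open>The operator identity (I - P_s)^2 = 2 (I - P_s) - (I - P_2s), which later serves as the
  halving step from \<open>D (2 * s)\<close> to \<open>D s\<close>.\<close>

lemma D_D:
  assumes "1 \<le> q" "0 \<le> s" "f \<in> Lp_space M q"
  shows "AE x in M. D s (D s f) x = 2 * D s f x - D (2 * s) f x"
  using P_diff[OF assms P_Lp(1)[OF assms]] P_add[OF assms(1,2) assms(2,3)]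
  unfolding heat_diff_def mult_2 by eventually_elim simp

subsection \<open>The exponent two\<close>

text \<open>Self-adjointness moves one of the two factors P_t to the other argument. Hence t -> <P_t
  f, f> is non-negative.\<close>

lemma L2_inner_P_half:
  assumes "0 \<le> t" "f \<in> Lp_space M 2"
  shows "L2_inner M (P (2 * t) f) f = (Lp_norm M 2 (P t f))\<^sup>2"
proof -
  have Pf: "P t f \<in> Lp_space M 2" "P t (P t f) \<in> Lp_space M 2" "P (2 * t) f \<in> Lp_space M 2"
    using assms by (auto intro!: P_Lp)
  have "L2_inner M (P (2 * t) f) f = L2_inner M (P t (P t f)) f"
    using P_add[of 2 t t f] assms by (intro L2_inner_cong_AE Pf) auto
  also have "\<dots> = (Lp_norm M 2 (P t f))\<^sup>2"
    using assms Pf by (simp add: self_adjoint Lp_norm_2)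
  finally show ?thesis .
qed

text \<open>The norm is <P_t D_s f, D_s f>; moving the right-hand \<open>D s\<close> across the
  inner product gives P_t (I - P_s)^2 = P_t - 2 P_(t+s) + P_(t+2s). Second differences of t -> <P_t
  f, f> are thus squared norms.\<close>

lemma L2_second_difference:
  assumes s: "0 \<le> s" and t: "0 \<le> t" and f: "f \<in> Lp_space M 2"
  shows "(Lp_norm M 2 (P (t / 2) (D s f)))\<^sup>2
    = L2_inner M (P t f) f - 2 * L2_inner M (P (t + s) f) f + L2_inner M (P (t + 2 * s) f) f"
proof -
  have [simp]: "(1::real) \<le> 2"
    by simp
  note L = P_Lp(1)[of 2] D_Lp(1)[of 2]
  have mem: "P s f \<in> Lp_space M 2" "P t f \<in> Lp_space M 2" "P (t + s) f \<in> Lp_space M 2"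
    "P (t + 2 * s) f \<in> Lp_space M 2" "D s f \<in> Lp_space M 2" "P t (P s f) \<in> Lp_space M 2"
    "P t (D s f) \<in> Lp_space M 2" "P s (P t f) \<in> Lp_space M 2" "P s (P (t + s) f) \<in> Lp_space M 2"
    using s t f by (auto intro!: L)
  have ts: "AE x in M. P t (P s f) x = P (t + s) f x"
    using P_add[of 2 t s f] s t f by auto
  have tss: "AE x in M. P s (P (t + s) f) x = P (t + 2 * s) f x"
    using P_add[of 2 s "t + s" f] s t f by (auto simp: algebra_simps)
  have st: "AE x in M. P s (P t f) x = P (t + s) f x"
    using P_add[of 2 s t f] s t f by (auto simp: algebra_simps)
  have D_right: "L2_inner M g (D s f) = L2_inner M g f - L2_inner M (P s g) f"
    if g: "g \<in> Lp_space M 2" for g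
  proof -
    have "L2_inner M (D s f) g = L2_inner M f g - L2_inner M (P s f) g"
      unfolding heat_diff_def using mem f g by (intro L2_inner_diff_left)
    also have "L2_inner M (P s f) g = L2_inner M f (P s g)"
      using s f g by (rule self_adjoint)
    finally show ?thesis
      by (simp only: L2_inner_commute[of M f] L2_inner_commute[of M "D s f"])
  qed
  have "(Lp_norm M 2 (P (t / 2) (D s f)))\<^sup>2 = L2_inner M (P t (D s f)) (D s f)"
    using L2_inner_P_half[of "t / 2" "D s f"] t mem by simp
  also have "\<dots> = L2_inner M (\<lambda>x. P t f x - P (t + s) f x) (D s f)"
    using P_diff[of 2 t f "P s f"] ts s t f mem
    by (intro L2_inner_cong_AE) (auto intro!: Lp_diff(1) simp: heat_diff_def elim: AE_mp)
  also have "\<dots> = L2_inner M (P t f) (D s f) - L2_inner M (P (t + s) f) (D s f)"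
    using mem by (simp add: L2_inner_diff_left)
  also have "L2_inner M (P t f) (D s f) = L2_inner M (P t f) f - L2_inner M (P s (P t f)) f"
    using mem by (intro D_right)
  also have "L2_inner M (P s (P t f)) f = L2_inner M (P (t + s) f) f"
    using st mem f by (intro L2_inner_cong_AE) auto
  also have "L2_inner M (P (t + s) f) (D s f) = L2_inner M (P (t + s) f) f - L2_inner M (P s (P (t + s) f)) f"
    using mem by (intro D_right)
  also have "L2_inner M (P s (P (t + s) f)) f = L2_inner M (P (t + 2 * s) f) f"
    using tss mem f by (intro L2_inner_cong_AE) auto
  finally show ?thesis
    by simp
qed

text \<open>Sampled at multiples of s, <P_t f, f> is non-negative and decreasing, and its second
  differences decrease as well. Their sum with weights m + 1 is at most the squared norm of f, so
  the n-th one is O(n^-2); for n of order t / s it dominates the squared norm on the left.\<close>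

lemma L2_smoothing:
  assumes s: "0 < s" "s \<le> t" and f: "f \<in> Lp_space M 2"
  shows "Lp_norm M 2 (D s (P t f)) \<le> 2 * (s / t) * Lp_norm M 2 f"
proof -
  have [simp]: "(1::real) \<le> 2"
    by simp
  have Df: "D s f \<in> Lp_space M 2"
    using s f by (intro D_Lp) auto
  \<comment> \<open>\<open>\<psi>\<close> is the second difference of \<open>\<phi>\<close>, so \<open>\<Sum>m<n. (m + 1) * \<psi> m\<close> is at most \<open>\<phi> 0\<close>\<close>
  define \<phi> where "\<phi> m = L2_inner M (P (real m * s) f) f" for m :: nat
  define \<psi> where "\<psi> m = (Lp_norm M 2 (P (real m * s / 2) (D s f)))\<^sup>2" for m :: nat
  have \<psi>: "\<psi> m = \<phi> m - 2 * \<phi> (m + 1) + \<phi> (m + 2)" for m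
    using L2_second_difference[of s "real m * s" f] s f
    by (simp add: \<psi>_def \<phi>_def algebra_simps)
  have \<phi>: "\<phi> m = (Lp_norm M 2 (P (real m * s / 2) f))\<^sup>2" for m
    using L2_inner_P_half[of "real m * s / 2" f] s f by (simp add: \<phi>_def)
  have norm_antimono: "Lp_norm M 2 (P b g) \<le> Lp_norm M 2 (P a g)"
    if "0 \<le> a" "a \<le> b" "g \<in> Lp_space M 2" for a b g
  proof -
    have mem: "P a g \<in> Lp_space M 2" "P (b - a) (P a g) \<in> Lp_space M 2" "P b g \<in> Lp_space M 2"
      using that by (auto intro!: P_Lp)
    have "Lp_norm M 2 (P b g) = Lp_norm M 2 (P (b - a) (P a g))"
      using P_add[of 2 "b - a" a g] that mem by (intro Lp_norm_cong_AE) auto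
    also have "\<dots> \<le> Lp_norm M 2 (P a g)"
      using that mem by (intro P_Lp) auto
    finally show ?thesis .
  qed
  have \<phi>_mono: "\<phi> (Suc m) \<le> \<phi> m" for m
    unfolding \<phi> using s f by (intro power_mono norm_antimono) auto
  have \<phi>_nonneg: "0 \<le> \<phi> m" for m
    by (simp add: \<phi>)
  have \<psi>_mono: "\<psi> n \<le> \<psi> m" if "m \<le> n" for m n
    unfolding \<psi>_def using s that Df by (intro power_mono norm_antimono) auto
  \<comment> \<open>Summation by parts: the weights m + 1 undo the second difference, and only
    boundary terms remain.\<close>
  have sum_eq: "(\<Sum>m<n. real (m + 1) * \<psi> m) = \<phi> 0 - \<phi> n - real n * (\<phi> n - \<phi> (Suc n))" for n
    by (induction n) (auto simp: \<psi> algebra_simps)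
  \<comment> \<open>\<open>\<psi> n\<close> involves the semigroup at time n s / 2, so n s / 2 <= t
    lets it dominate the norm at time t. Since t / s >= 1, rounding 2 t / s down still leaves n >= t
    / s.\<close>
  define n where "n = nat \<lfloor>2 * t / s\<rfloor>"
  have t: "0 < t"
    using s by simp
  have "1 \<le> t / s"
    using s by simp
  then have n1: "real n \<le> 2 * t / s" and n2: "t / s \<le> real n"
    unfolding n_def using s t by linarith+
  have "(\<Sum>m<n. real (m + 1)) = real n * (real n + 1) / 2"
    by (induction n) (auto simp: field_simps)
  then have "(real n)\<^sup>2 / 2 * \<psi> n \<le> (\<Sum>m<n. real (m + 1)) * \<psi> n"
    by (intro mult_right_mono) (auto simp: \<psi>_def power2_eq_square field_simps)
  also have "\<dots> \<le> (\<Sum>m<n. real (m + 1) * \<psi> m)"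
    unfolding sum_distrib_right by (intro sum_mono mult_left_mono \<psi>_mono) auto
  also have "\<dots> \<le> \<phi> 0"
  proof -
    have "0 \<le> real n * (\<phi> n - \<phi> (Suc n))"
      using \<phi>_mono[of n] by simp
    then show ?thesis
      unfolding sum_eq using \<phi>_nonneg[of n] by linarith
  qed
  also have "\<dots> = (Lp_norm M 2 f)\<^sup>2"
    unfolding \<phi> using P_0[of 2 f] f P_Lp(1)[of 2 0 f]
    by (intro arg_cong[where f = "\<lambda>x. x\<^sup>2"] Lp_norm_cong_AE) auto
  finally have n3: "(real n)\<^sup>2 / 2 * \<psi> n \<le> (Lp_norm M 2 f)\<^sup>2" .
  have "Lp_norm M 2 (D s (P t f)) = Lp_norm M 2 (P t (D s f))"
    using P_D_commute[of 2 s t f] s t f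
    by (intro Lp_norm_cong_AE) (auto intro!: Lp_space_measurable[of _ M 2] P_Lp D_Lp)
  also have "\<dots> \<le> Lp_norm M 2 (P (real n * s / 2) (D s f))"
    using n1 s Df by (intro norm_antimono) (auto simp: field_simps)
  finally have "(t / s)\<^sup>2 / 2 * (Lp_norm M 2 (D s (P t f)))\<^sup>2 \<le> (real n)\<^sup>2 / 2 * \<psi> n"
    unfolding \<psi>_def using n2 s t by (intro mult_mono divide_right_mono power_mono) auto
  also note n3
  finally have "(Lp_norm M 2 (D s (P t f)))\<^sup>2 \<le> 2 * (s / t)\<^sup>2 * (Lp_norm M 2 f)\<^sup>2"
    using s t by (simp add: field_simps)
  \<comment> \<open>The factor 2 is relaxed to 4 to make the right side a perfect square.\<close>
  also have "\<dots> \<le> 4 * (s / t)\<^sup>2 * (Lp_norm M 2 f)\<^sup>2"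
    using zero_le_power2[of "s / t * Lp_norm M 2 f"] unfolding power_mult_distrib by linarith
  also have "\<dots> = (2 * (s / t) * Lp_norm M 2 f)\<^sup>2"
    unfolding power_mult_distrib by simp
  finally show ?thesis
    by (rule power2_le_imp_le) (use s t in auto)
qed

end

section \<open>Marcinkiewicz interpolation\<close>

lemma nn_integral_powr_from_0:
  fixes a b :: real
  assumes "-1 < a" "0 \<le> b"
  shows "(\<integral>\<^sup>+x. ennreal (if 0 \<le> x \<and> x \<le> b then x powr a else 0) \<partial>lborel)
    = ennreal (b powr (a + 1) / (a + 1))"
proof -
  have "(\<integral>\<^sup>+x. ennreal (indicator {0..b} x * (x powr a)) \<partial>lborel) = ennreal (b powr (a + 1) / (a + 1))"
    by (rule nn_integral_has_integral_lebesgue[OF _ has_integral_powr_from_0[OF assms]]) auto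
  moreover have "indicator {0..b} x * (x powr a) = (if 0 \<le> x \<and> x \<le> b then x powr a else 0)" for x
    by (simp add: indicator_def)
  ultimately show ?thesis
    by (simp only:)
qed

lemma nn_integral_powr_to_inf:
  fixes a b :: real
  assumes "a < -1" "0 < b"
  shows "(\<integral>\<^sup>+x. ennreal (if b \<le> x then x powr a else 0) \<partial>lborel)
    = ennreal (b powr (a + 1) / - (a + 1))"
proof -
  have "(\<integral>\<^sup>+x. ennreal (indicator {b..} x * (x powr a)) \<partial>lborel) = ennreal (- (b powr (a + 1)) / (a + 1))"
    by (rule nn_integral_has_integral_lebesgue[OF _ has_integral_powr_to_inf[OF assms]]) auto
  moreover have "indicator {b..} x * (x powr a) = (if b \<le> x then x powr a else 0)" for x
    by (simp add: indicator_def)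
  moreover have "- (b powr (a + 1)) / (a + 1) = b powr (a + 1) / - (a + 1)"
    by (metis minus_divide_left minus_divide_right)
  ultimately show ?thesis
    by (simp only:)
qed

text \<open>Layer cake: |v|^p is the integral of p l^(p-1) over 0 <= l <= |v|. Insert the weak bound
  at each level and exchange the integrals. The integral over small l converges because p > 1, the
  one over large l because p < q; both scale like |f|^p.\<close>

lemma (in sigma_finite_measure) weak_type_sum_bound:
  fixes p q c N K :: real
  assumes p: "1 < p" "p < q" and pos: "0 < c" "0 \<le> N" "0 \<le> K"
    and v [measurable]: "v \<in> borel_measurable M" and f [measurable]: "f \<in> borel_measurable M"
    and weak: "\<And>l. 0 < l \<Longrightarrow> (\<integral>\<^sup>+x. (if l \<le> \<bar>v x\<bar> then 1 else 0) \<partial>M)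
      \<le> (\<integral>\<^sup>+x. ennreal (N / l * (if c * l < \<bar>f x\<bar> then \<bar>f x\<bar> else 0)) \<partial>M)
        + (\<integral>\<^sup>+x. ennreal (K / l powr q * (if \<bar>f x\<bar> \<le> c * l then \<bar>f x\<bar> powr q else 0)) \<partial>M)"
  shows "(\<integral>\<^sup>+x. ennreal (\<bar>v x\<bar> powr p) \<partial>M)
    \<le> ennreal (p * N * c powr (1 - p) / (p - 1) + p * K * c powr (q - p) / (q - p))
        * (\<integral>\<^sup>+x. ennreal (\<bar>f x\<bar> powr p) \<partial>M)"
proof -
  interpret pair_sigma_finite M lborel
    by unfold_locales
  \<comment> \<open>After the exchange x is fixed, and the two conditions on |f x| become ranges of
    l. The factors 1 / l and \<open>1 / l powr q\<close> lower the exponent p - 1 to p - 2 and p - 1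
    - q. Including the end point in the first range only enlarges the bound.\<close>
  let ?E = "\<lambda>x l. if 0 \<le> l \<and> l \<le> \<bar>f x\<bar> / c then l powr (p - 2) else 0 :: real"
  let ?G = "\<lambda>x l. if \<bar>f x\<bar> / c \<le> l then l powr (p - 1 - q) else 0 :: real"
  let ?H = "\<lambda>x l. ennreal (p * N * \<bar>f x\<bar>) * ennreal (?E x l)
      + ennreal (p * K * \<bar>f x\<bar> powr q) * ennreal (?G x l)"
  have 1: "ennreal (\<bar>v x\<bar> powr p)
      = (\<integral>\<^sup>+l. ennreal p * ennreal (if 0 \<le> l \<and> l \<le> \<bar>v x\<bar> then l powr (p - 1) else 0) \<partial>lborel)" for x
    using nn_integral_powr_from_0[of "p - 1" "\<bar>v x\<bar>"] p
    by (subst nn_integral_cmult) (auto simp: ennreal_mult[symmetric])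
  have 2: "(\<integral>\<^sup>+x. ennreal p * ennreal (if 0 \<le> l \<and> l \<le> \<bar>v x\<bar> then l powr (p - 1) else 0) \<partial>M)
      \<le> (\<integral>\<^sup>+x. ?H x l \<partial>M)" for l :: real
  proof (cases "0 < l")
    case False
    then have "(if 0 \<le> l \<and> l \<le> \<bar>v x\<bar> then l powr (p - 1) else 0) = 0" for x
      by auto
    then show ?thesis
      by simp
  next
    case True
    have "(\<integral>\<^sup>+x. ennreal p * ennreal (if 0 \<le> l \<and> l \<le> \<bar>v x\<bar> then l powr (p - 1) else 0) \<partial>M)
        = (\<integral>\<^sup>+x. ennreal (p * l powr (p - 1)) * (if l \<le> \<bar>v x\<bar> then 1 else 0) \<partial>M)"
      using True p by (intro nn_integral_cong) (auto simp: ennreal_mult)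
    also have "\<dots> = ennreal (p * l powr (p - 1)) * (\<integral>\<^sup>+x. (if l \<le> \<bar>v x\<bar> then 1 else 0) \<partial>M)"
      by (rule nn_integral_cmult) simp
    also have "\<dots> \<le> ennreal (p * l powr (p - 1)) *
        ((\<integral>\<^sup>+x. ennreal (N / l * (if c * l < \<bar>f x\<bar> then \<bar>f x\<bar> else 0)) \<partial>M)
        + (\<integral>\<^sup>+x. ennreal (K / l powr q * (if \<bar>f x\<bar> \<le> c * l then \<bar>f x\<bar> powr q else 0)) \<partial>M))"
      by (rule mult_left_mono[OF weak[OF True]]) simp
    also have "\<dots> = (\<integral>\<^sup>+x. ennreal (p * l powr (p - 1)) *
        (ennreal (N / l * (if c * l < \<bar>f x\<bar> then \<bar>f x\<bar> else 0))
        + ennreal (K / l powr q * (if \<bar>f x\<bar> \<le> c * l then \<bar>f x\<bar> powr q else 0))) \<partial>M)"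
      by (subst nn_integral_add[symmetric], measurable, rule nn_integral_cmult[symmetric], measurable)
    also have "\<dots> \<le> (\<integral>\<^sup>+x. ?H x l \<partial>M)"
    proof (rule nn_integral_mono)
      fix x
      have a: "p * l powr (p - 1) * (N / l) = p * N * l powr (p - 2)"
        using True powr_diff[of l "p - 1" 1] by (simp add: field_simps)
      have b: "p * l powr (p - 1) * (K / l powr q) = p * K * l powr (p - 1 - q)"
        using True powr_diff[of l "p - 1" q] by (simp add: field_simps)
      have A: "p * l powr (p - 1) * (N / l * (if c * l < \<bar>f x\<bar> then \<bar>f x\<bar> else 0))
          \<le> p * N * \<bar>f x\<bar> * ?E x l"
        unfolding mult.assoc[symmetric, where a = "p * l powr (p - 1)"] a using p pos True
        by (auto simp: pos_le_divide_eq mult.commute mult.left_commute)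
      have B: "p * l powr (p - 1) * (K / l powr q * (if \<bar>f x\<bar> \<le> c * l then \<bar>f x\<bar> powr q else 0))
          \<le> p * K * \<bar>f x\<bar> powr q * ?G x l"
        unfolding mult.assoc[symmetric, where a = "p * l powr (p - 1)"] b using p pos True
        by (auto simp: pos_divide_le_eq mult.commute mult.left_commute)
      have "ennreal (p * l powr (p - 1)) *
        (ennreal (N / l * (if c * l < \<bar>f x\<bar> then \<bar>f x\<bar> else 0))
        + ennreal (K / l powr q * (if \<bar>f x\<bar> \<le> c * l then \<bar>f x\<bar> powr q else 0)))
        = ennreal (p * l powr (p - 1) * (N / l * (if c * l < \<bar>f x\<bar> then \<bar>f x\<bar> else 0)))
        + ennreal (p * l powr (p - 1) * (K / l powr q * (if \<bar>f x\<bar> \<le> c * l then \<bar>f x\<bar> powr q else 0)))"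
        using p by (simp only: distrib_left ennreal_mult' powr_ge_zero mult_nonneg_nonneg)
      also have "\<dots> \<le> ennreal (p * N * \<bar>f x\<bar> * ?E x l) + ennreal (p * K * \<bar>f x\<bar> powr q * ?G x l)"
        using A B by (intro add_mono ennreal_leI)
      also have "\<dots> = ?H x l"
        using p pos by (subst (1 2) ennreal_mult') auto
      finally show "ennreal (p * l powr (p - 1)) *
        (ennreal (N / l * (if c * l < \<bar>f x\<bar> then \<bar>f x\<bar> else 0))
        + ennreal (K / l powr q * (if \<bar>f x\<bar> \<le> c * l then \<bar>f x\<bar> powr q else 0))) \<le> ?H x l" .
    qed
    finally show ?thesis .
  qed
  have 3: "(\<integral>\<^sup>+l. ?H x l \<partial>lborel)
      = ennreal (p * N * c powr (1 - p) / (p - 1) + p * K * c powr (q - p) / (q - p))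
        * ennreal (\<bar>f x\<bar> powr p)" for x
  \<comment> \<open>At a zero of f the tail integral would start at 0 and diverge, but its
    coefficient is 0.\<close>
  proof (cases "f x = 0")
    case True
    then show ?thesis
      using p by simp
  next
    case False
    have E: "(\<integral>\<^sup>+l. ennreal (?E x l) \<partial>lborel) = ennreal ((\<bar>f x\<bar> / c) powr (p - 1) / (p - 1))"
      using nn_integral_powr_from_0[of "p - 2" "\<bar>f x\<bar> / c"] p pos by simp
    have G: "(\<integral>\<^sup>+l. ennreal (?G x l) \<partial>lborel) = ennreal ((\<bar>f x\<bar> / c) powr (p - q) / (q - p))"
      using nn_integral_powr_to_inf[of "p - 1 - q" "\<bar>f x\<bar> / c"] p pos False by simp
    have "(\<integral>\<^sup>+l. ?H x l \<partial>lborel) = ennreal (p * N * \<bar>f x\<bar>) * (\<integral>\<^sup>+l. ennreal (?E x l) \<partial>lborel)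
        + ennreal (p * K * \<bar>f x\<bar> powr q) * (\<integral>\<^sup>+l. ennreal (?G x l) \<partial>lborel)"
      by (subst nn_integral_add) (auto simp: nn_integral_cmult)
    also have "\<dots> = ennreal (p * N * \<bar>f x\<bar> * ((\<bar>f x\<bar> / c) powr (p - 1) / (p - 1))
        + p * K * \<bar>f x\<bar> powr q * ((\<bar>f x\<bar> / c) powr (p - q) / (q - p)))"
      unfolding E G using p pos by (subst (1 2) ennreal_mult'[symmetric]) auto
    also have "p * N * \<bar>f x\<bar> * ((\<bar>f x\<bar> / c) powr (p - 1) / (p - 1))
        = p * N * c powr (1 - p) / (p - 1) * \<bar>f x\<bar> powr p"
    proof -
      have "(\<bar>f x\<bar> / c) powr (p - 1) * \<bar>f x\<bar> = c powr (1 - p) * \<bar>f x\<bar> powr p"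
        using pos False by (simp add: powr_divide powr_diff)
      then show ?thesis
        by (simp add: mult_ac)
    qed
    also have "p * K * \<bar>f x\<bar> powr q * ((\<bar>f x\<bar> / c) powr (p - q) / (q - p))
        = p * K * c powr (q - p) / (q - p) * \<bar>f x\<bar> powr p"
    proof -
      have "(\<bar>f x\<bar> / c) powr (p - q) * \<bar>f x\<bar> powr q = c powr (q - p) * \<bar>f x\<bar> powr p"
        using pos False by (simp add: powr_divide powr_diff)
      then show ?thesis
        by (simp add: mult_ac)
    qed
    also have "ennreal (p * N * c powr (1 - p) / (p - 1) * \<bar>f x\<bar> powr p
        + p * K * c powr (q - p) / (q - p) * \<bar>f x\<bar> powr p)
      = ennreal (p * N * c powr (1 - p) / (p - 1) + p * K * c powr (q - p) / (q - p))
        * ennreal (\<bar>f x\<bar> powr p)"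
      unfolding distrib_right[symmetric] by (rule ennreal_mult') (use p pos in auto)
    finally show ?thesis .
  qed
  have "(\<integral>\<^sup>+x. ennreal (\<bar>v x\<bar> powr p) \<partial>M)
    = (\<integral>\<^sup>+l. (\<integral>\<^sup>+x. ennreal p * ennreal (if 0 \<le> l \<and> l \<le> \<bar>v x\<bar> then l powr (p - 1) else 0) \<partial>M) \<partial>lborel)"
    unfolding 1 by (rule Fubini'[symmetric]) measurable
  also have "\<dots> \<le> (\<integral>\<^sup>+l. (\<integral>\<^sup>+x. ?H x l \<partial>M) \<partial>lborel)"
    by (intro nn_integral_mono 2)
  also have "\<dots> = (\<integral>\<^sup>+x. (\<integral>\<^sup>+l. ?H x l \<partial>lborel) \<partial>M)"
    by (rule Fubini') measurable
  also have "\<dots> = ennreal (p * N * c powr (1 - p) / (p - 1) + p * K * c powr (q - p) / (q - p))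
        * (\<integral>\<^sup>+x. ennreal (\<bar>f x\<bar> powr p) \<partial>M)"
    unfolding 3 by (rule nn_integral_cmult) simp
  finally show ?thesis .
qed

lemma integral_le_of_nn_integral_le:
  fixes f g :: "'a \<Rightarrow> real"
  assumes "integrable M f" "integrable M g" "\<And>x. 0 \<le> f x" "\<And>x. 0 \<le> g x" "0 \<le> C"
    and le: "(\<integral>\<^sup>+x. ennreal (f x) \<partial>M) \<le> ennreal C * (\<integral>\<^sup>+x. ennreal (g x) \<partial>M)"
  shows "(LINT x|M. f x) \<le> C * (LINT x|M. g x)"
proof -
  have "ennreal (LINT x|M. f x) \<le> ennreal (C * (LINT x|M. g x))"
    using le assms by (simp add: nn_integral_eq_integral ennreal_mult')
  then show ?thesis
    using assms by (subst (asm) ennreal_le_iff) (auto intro!: mult_nonneg_nonneg integral_nonneg_AE)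
qed

lemma nn_integral_Lp:
  assumes "f \<in> Lp_space M q" "0 < q"
  shows "(\<integral>\<^sup>+x. ennreal (\<bar>f x\<bar> powr q) \<partial>M) = ennreal (Lp_norm M q f powr q)"
  using assms by (simp add: Lp_norm_powr Lp_space_def nn_integral_eq_integral)

text \<open>At each level l the function is cut at height c l; the large part is controlled by the
  bound on L^1, the small part by the bound on L^q. The parameter c is left free so that a later
  choice can balance the two contributions when \<open>K\<close> is small.\<close>

theorem (in sigma_finite_measure) marcinkiewicz_interpolation:
  fixes p q c N K :: real
  assumes p: "1 < p" "p < q" and pos: "0 < c" "0 \<le> N" "0 \<le> K"
    and A1: "\<And>g. g \<in> Lp_space M 1 \<Longrightarrow> A g \<in> Lp_space M 1 \<and> Lp_norm M 1 (A g) \<le> N * Lp_norm M 1 g"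
    and Aq: "\<And>g. g \<in> Lp_space M q \<Longrightarrow> A g \<in> Lp_space M q \<and> Lp_norm M q (A g) \<le> K * Lp_norm M q g"
    and Ap: "\<And>g. g \<in> Lp_space M p \<Longrightarrow> A g \<in> Lp_space M p"
    and add: "\<And>g h. g \<in> Lp_space M p \<Longrightarrow> h \<in> Lp_space M p \<Longrightarrow>
      AE x in M. A (\<lambda>x. g x + h x) x = A g x + A h x"
    and f: "f \<in> Lp_space M p"
  shows "(LINT x|M. \<bar>A f x\<bar> powr p)
    \<le> (p * (2 * N) * c powr (1 - p) / (p - 1) + p * (2 * K) powr q * c powr (q - p) / (q - p))
        * (LINT x|M. \<bar>f x\<bar> powr p)"
proof (rule integral_le_of_nn_integral_le)
  note [measurable] = Lp_spaceD(1)[OF f] Lp_spaceD(1)[OF Ap[OF f]]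
  show "(\<integral>\<^sup>+x. ennreal (\<bar>A f x\<bar> powr p) \<partial>M)
    \<le> ennreal (p * (2 * N) * c powr (1 - p) / (p - 1) + p * (2 * K) powr q * c powr (q - p) / (q - p))
        * (\<integral>\<^sup>+x. ennreal (\<bar>f x\<bar> powr p) \<partial>M)"
  proof (rule weak_type_sum_bound[OF p pos(1)])
    fix l :: real
    assume l: "0 < l"
    \<comment> \<open>The large part g is in L^1 because |f| <= (c l)^(1-p) |f|^p where |f| > c l;
      the small part h is in L^q because |f|^q <= (c l)^(q-p) |f|^p where |f| <= c l.\<close>
    define g where "g x = (if c * l < \<bar>f x\<bar> then f x else 0)" for x
    define h where "h x = (if \<bar>f x\<bar> \<le> c * l then f x else 0)" for x
    have [measurable]: "g \<in> borel_measurable M" "h \<in> borel_measurable M"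
      unfolding g_def h_def by measurable
    have cl: "0 < c * l"
      using pos l by simp
    have intf: "integrable M (\<lambda>x. \<bar>f x\<bar> powr p)"
      using f by (simp add: Lp_space_def)
    have gp: "g \<in> Lp_space M p"
      unfolding Lp_space_def
      by (auto intro!: Bochner_Integration.integrable_bound[OF intf] AE_I2 simp: g_def)
    have hp: "h \<in> Lp_space M p"
      unfolding Lp_space_def
      by (auto intro!: Bochner_Integration.integrable_bound[OF intf] AE_I2 simp: h_def)
    have "integrable M (\<lambda>x. \<bar>g x\<bar> powr 1)"
    proof (rule Bochner_Integration.integrable_bound)
      show "integrable M (\<lambda>x. (c * l) powr (1 - p) * \<bar>f x\<bar> powr p)"
        using intf by simp
      show "AE x in M. norm (\<bar>g x\<bar> powr 1) \<le> norm ((c * l) powr (1 - p) * \<bar>f x\<bar> powr p)"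
      proof (rule AE_I2)
        fix x
        have "\<bar>f x\<bar> \<le> (c * l) powr (1 - p) * \<bar>f x\<bar> powr p" if "c * l < \<bar>f x\<bar>"
        proof -
          have "\<bar>f x\<bar> powr (1 - p) * \<bar>f x\<bar> powr p \<le> (c * l) powr (1 - p) * \<bar>f x\<bar> powr p"
            using that cl p by (intro mult_right_mono powr_mono2') auto
          moreover have "\<bar>f x\<bar> powr (1 - p) * \<bar>f x\<bar> powr p = \<bar>f x\<bar>"
            using that cl by (simp add: powr_add[symmetric])
          ultimately show ?thesis
            by simp
        qed
        then show "norm (\<bar>g x\<bar> powr 1) \<le> norm ((c * l) powr (1 - p) * \<bar>f x\<bar> powr p)"
          by (simp add: g_def)
      qed
    qed simp
    then have g1: "g \<in> Lp_space M 1"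
      by (simp add: Lp_space_def)
    have "integrable M (\<lambda>x. \<bar>h x\<bar> powr q)"
    proof (rule Bochner_Integration.integrable_bound)
      show "integrable M (\<lambda>x. (c * l) powr (q - p) * \<bar>f x\<bar> powr p)"
        using intf by simp
      show "AE x in M. norm (\<bar>h x\<bar> powr q) \<le> norm ((c * l) powr (q - p) * \<bar>f x\<bar> powr p)"
      proof (rule AE_I2)
        fix x
        have "\<bar>f x\<bar> powr q \<le> (c * l) powr (q - p) * \<bar>f x\<bar> powr p" if "\<bar>f x\<bar> \<le> c * l"
        proof -
          have "\<bar>f x\<bar> powr (q - p) * \<bar>f x\<bar> powr p \<le> (c * l) powr (q - p) * \<bar>f x\<bar> powr p"
            using that cl p by (intro mult_right_mono powr_mono2) auto
          then show ?thesis
            by (simp add: powr_add[symmetric])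
        qed
        then show "norm (\<bar>h x\<bar> powr q) \<le> norm ((c * l) powr (q - p) * \<bar>f x\<bar> powr p)"
          by (simp add: h_def)
      qed
    qed simp
    then have hq: "h \<in> Lp_space M q"
      by (simp add: Lp_space_def)
    have [measurable]: "A g \<in> borel_measurable M" "A h \<in> borel_measurable M"
      using Ap[OF gp] Ap[OF hp] by auto
    have "f = (\<lambda>x. g x + h x)"
      by (auto simp: g_def h_def)
    then have Af: "AE x in M. A f x = A g x + A h x"
      using add[OF gp hp] by simp
    have "(\<integral>\<^sup>+x. (if l \<le> \<bar>A f x\<bar> then 1 else 0) \<partial>M)
        \<le> (\<integral>\<^sup>+x. ennreal (2 / l) * ennreal (\<bar>A g x\<bar> powr 1)
          + ennreal ((2 / l) powr q) * ennreal (\<bar>A h x\<bar> powr q) \<partial>M)"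
    proof (rule nn_integral_mono_AE, use Af in eventually_elim)
      fix x
      assume x: "A f x = A g x + A h x"
      show "(if l \<le> \<bar>A f x\<bar> then 1 else 0) \<le> ennreal (2 / l) * ennreal (\<bar>A g x\<bar> powr 1)
          + ennreal ((2 / l) powr q) * ennreal (\<bar>A h x\<bar> powr q)"
      proof (cases "l \<le> \<bar>A f x\<bar>")
        case True
        \<comment> \<open>One of the two images reaches half the level. Chebyshev's inequality with
          exponent 1 or q then produces the factors 2 / l, hence \<open>2 * N\<close> and
          \<open>2 * K\<close> in the conclusion.\<close>
        then consider "l / 2 \<le> \<bar>A g x\<bar>" | "l / 2 \<le> \<bar>A h x\<bar>"
          using x by linarith
        then have "1 \<le> 2 / l * \<bar>A g x\<bar> powr 1 + (2 / l) powr q * \<bar>A h x\<bar> powr q"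
        proof cases
          case 1
          then have "1 \<le> 2 / l * \<bar>A g x\<bar>"
            using l by (simp add: field_simps)
          then show ?thesis
            by (simp add: add_increasing2)
        next
          case 2
          then have "1 \<le> 2 / l * \<bar>A h x\<bar>"
            using l by (simp add: field_simps)
          then have "1 \<le> (2 / l * \<bar>A h x\<bar>) powr q"
            using p by (intro ge_one_powr_ge_zero) auto
          also have "\<dots> = (2 / l) powr q * \<bar>A h x\<bar> powr q"
            by (rule powr_mult)
          also have "\<dots> \<le> 2 / l * \<bar>A g x\<bar> powr 1 + (2 / l) powr q * \<bar>A h x\<bar> powr q"
            using l by simp
          finally show ?thesis .
        qed
        then have "ennreal 1 \<le> ennreal (2 / l * \<bar>A g x\<bar> powr 1 + (2 / l) powr q * \<bar>A h x\<bar> powr q)"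
          by (rule ennreal_leI)
        also have "\<dots> = ennreal (2 / l) * ennreal (\<bar>A g x\<bar> powr 1)
          + ennreal ((2 / l) powr q) * ennreal (\<bar>A h x\<bar> powr q)"
          using l by (subst (1 2) ennreal_mult'[symmetric]) auto
        finally show ?thesis
          using True by simp
      qed simp
    qed
    also have "\<dots> = ennreal (2 / l) * (\<integral>\<^sup>+x. ennreal (\<bar>A g x\<bar> powr 1) \<partial>M)
        + ennreal ((2 / l) powr q) * (\<integral>\<^sup>+x. ennreal (\<bar>A h x\<bar> powr q) \<partial>M)"
      by (subst nn_integral_add) (auto simp: nn_integral_cmult)
    also have "\<dots> \<le> ennreal (2 / l) * ennreal (N * (Lp_norm M 1 g powr 1))
        + ennreal ((2 / l) powr q) * ennreal (K powr q * Lp_norm M q h powr q)"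
    proof (intro add_mono mult_left_mono)
      show "(\<integral>\<^sup>+x. ennreal (\<bar>A g x\<bar> powr 1) \<partial>M) \<le> ennreal (N * (Lp_norm M 1 g powr 1))"
        using A1[OF g1] by (subst nn_integral_Lp) (auto intro!: ennreal_leI)
      have "Lp_norm M q (A h) powr q \<le> (K * Lp_norm M q h) powr q"
        using Aq[OF hq] p by (intro powr_mono2) auto
      then show "(\<integral>\<^sup>+x. ennreal (\<bar>A h x\<bar> powr q) \<partial>M) \<le> ennreal (K powr q * Lp_norm M q h powr q)"
        using Aq[OF hq] p pos by (subst nn_integral_Lp) (auto intro!: ennreal_leI simp: powr_mult)
    qed auto
    also have "\<dots> = ennreal (2 * N / l) * (\<integral>\<^sup>+x. ennreal (\<bar>g x\<bar> powr 1) \<partial>M)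
        + ennreal ((2 * K) powr q / l powr q) * (\<integral>\<^sup>+x. ennreal (\<bar>h x\<bar> powr q) \<partial>M)"
      using l p pos unfolding nn_integral_Lp[OF g1 zero_less_one]
      by (subst nn_integral_Lp[OF hq])
        (auto simp: ennreal_mult'[symmetric] powr_divide powr_mult mult_ac)
    also have "\<dots> = (\<integral>\<^sup>+x. ennreal (2 * N / l * (if c * l < \<bar>f x\<bar> then \<bar>f x\<bar> else 0)) \<partial>M)
        + (\<integral>\<^sup>+x. ennreal ((2 * K) powr q / l powr q * (if \<bar>f x\<bar> \<le> c * l then \<bar>f x\<bar> powr q else 0)) \<partial>M)"
    proof (intro arg_cong2[where f = "(+)"])
      show "ennreal (2 * N / l) * (\<integral>\<^sup>+x. ennreal (\<bar>g x\<bar> powr 1) \<partial>M)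
          = (\<integral>\<^sup>+x. ennreal (2 * N / l * (if c * l < \<bar>f x\<bar> then \<bar>f x\<bar> else 0)) \<partial>M)"
        using l pos by (subst nn_integral_cmult[symmetric])
          (auto intro!: nn_integral_cong simp: g_def ennreal_mult'[symmetric])
      show "ennreal ((2 * K) powr q / l powr q) * (\<integral>\<^sup>+x. ennreal (\<bar>h x\<bar> powr q) \<partial>M)
          = (\<integral>\<^sup>+x. ennreal ((2 * K) powr q / l powr q * (if \<bar>f x\<bar> \<le> c * l then \<bar>f x\<bar> powr q else 0)) \<partial>M)"
        using l pos by (subst nn_integral_cmult[symmetric])
          (auto intro!: nn_integral_cong simp: h_def ennreal_mult'[symmetric])
    qed
    finally show "(\<integral>\<^sup>+x. (if l \<le> \<bar>A f x\<bar> then 1 else 0) \<partial>M)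
      \<le> (\<integral>\<^sup>+x. ennreal (2 * N / l * (if c * l < \<bar>f x\<bar> then \<bar>f x\<bar> else 0)) \<partial>M)
        + (\<integral>\<^sup>+x. ennreal ((2 * K) powr q / l powr q * (if \<bar>f x\<bar> \<le> c * l then \<bar>f x\<bar> powr q else 0)) \<partial>M)" .
  qed (use pos in auto)
qed (use p pos Lp_spaceD(2)[OF f] Lp_spaceD(2)[OF Ap[OF f]] in auto)

section \<open>From second to first differences\<close>

text \<open>
  The term \<open>- 3 * C * x powr (3/2)\<close> in the inductive claim absorbs the error \<open>C * x powr (3/2)\<close>
  committed in each halving step, since \<open>3 * (sqrt 2 - 1) \<ge> 1\<close>.
\<close>

lemma marchaud_iteration:
  fixes a :: "real \<Rightarrow> real"
  assumes BC: "0 \<le> B" "0 \<le> C"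
    and bound: "\<And>x. 0 < x \<Longrightarrow> x \<le> 1 \<Longrightarrow> a x \<le> 2 * B"
    and halving: "\<And>x. 0 < x \<Longrightarrow> x \<le> 1 / 2 \<Longrightarrow> a x \<le> a (2 * x) / 2 + C * x powr (3/2)"
    and x: "0 < x" "x \<le> 1"
  shows "a x \<le> (4 * B + 3 * C) * x"
proof -
  \<comment> \<open>n bounds the number of doublings that bring x above 1/2, where the a priori
    bound applies.\<close>
  have claim: "a x \<le> (4 * B + 3 * C) * x - 3 * C * x powr (3/2)"
    if "(1 / 2) ^ n / 2 < x" "x \<le> 1" for n x
    using that
  proof (induction n arbitrary: x)
    case 0
    then have x: "1 / 2 < x" "x \<le> 1"
      by simp_all
    have "x powr (3/2) \<le> x"
      using powr_mono'[of 1 "3/2" x] x by simp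
    then have "3 * C * x powr (3/2) \<le> 3 * C * x"
      using BC by (intro mult_left_mono) auto
    moreover have "2 * B \<le> 4 * B * x"
      using mult_left_mono[of "1/2" x "4 * B"] x BC by simp
    moreover have "a x \<le> 2 * B"
      using bound x by simp
    ultimately show ?case
      by (simp add: distrib_right)
  next
    case (Suc n)
    show ?case
    proof (cases "x \<le> 1 / 2")
      case False
      then show ?thesis
        using Suc.IH[of x] Suc.prems power_le_one[of "1/2::real" n] by simp
    next
      case True
      have x0: "0 < x"
        using Suc.prems(1) by (smt (verit) divide_pos_pos zero_less_power)
      have "a (2 * x) \<le> (4 * B + 3 * C) * (2 * x) - 3 * C * (2 * x) powr (3/2)"
        using Suc.prems True by (intro Suc.IH) auto
      moreover have "(2 * x) powr (3/2) = 2 * sqrt 2 * x powr (3/2)"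
        using x0 powr_add[of 2 1 "1/2::real"] by (simp add: powr_mult powr_half_sqrt)
      ultimately have "a (2 * x) / 2 \<le> (4 * B + 3 * C) * x - 3 * C * (sqrt 2 * x powr (3/2))"
        by (simp add: field_simps)
      moreover have "C * x powr (3/2) \<le> C * x powr (3/2) * (3 * (sqrt 2 - 1))"
      proof -
        have "4 / 3 \<le> sqrt 2"
          by (rule real_le_rsqrt) (simp add: power2_eq_square)
        then have "1 \<le> 3 * (sqrt 2 - 1)"
          by simp
        then show ?thesis
          using BC mult_left_mono[of 1 "3 * (sqrt 2 - 1)" "C * x powr (3/2)"] by simp
      qed
      ultimately show ?thesis
        using halving[OF x0 True] by (simp add: algebra_simps)
    qed
  qed
  obtain n where "(1 / 2) ^ n < 2 * x"
    using real_arch_pow_inv[of "2 * x" "1/2"] x by auto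
  then have "a x \<le> (4 * B + 3 * C) * x - 3 * C * x powr (3/2)"
    using x by (intro claim[of n]) auto
  then show ?thesis
    using BC by (smt (verit) mult_nonneg_nonneg powr_ge_zero)
qed

section \<open>Second-order smoothing, interpolation and descent of the exponent\<close>

context heat_semigroup
begin

text \<open>Analyticity on L^q in difference form: the quotient s / t replaces a bound on t times
  the generator applied to P_t, so the estimate makes sense on all of L^q. For s >= t contraction
  already gives the factor 2.\<close>

definition smoothing :: "real \<Rightarrow> bool" where
  "smoothing q \<longleftrightarrow> (\<exists>C\<ge>0. \<forall>f\<in>Lp_space M q. \<forall>s t. 0 < s \<longrightarrow> s \<le> t \<longrightarrow>
     Lp_norm M q (D s (P t f)) \<le> C * (s / t) * Lp_norm M q f)"

text \<open>For s <= t / 2 the operator is the square of D_s P_(t/2), up to null sets, so the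
  first-order estimate at time t / 2 applies twice and gives 4 C^2. Otherwise (s / t)^2 is at least
  1/4, and the trivial norm bound 4 accounts for the summand 16.\<close>

lemma second_difference_smoothing:
  assumes q: "1 \<le> q" and "smoothing q"
  shows "\<exists>K\<ge>0. \<forall>f\<in>Lp_space M q. \<forall>s t. 0 < s \<longrightarrow> s \<le> t \<longrightarrow>
     Lp_norm M q (D s (D s (P t f))) \<le> K * (s / t)\<^sup>2 * Lp_norm M q f"
proof -
  obtain C where C: "0 \<le> C" and sm: "\<And>f s t. f \<in> Lp_space M q \<Longrightarrow> 0 < s \<Longrightarrow> s \<le> t \<Longrightarrow>
     Lp_norm M q (D s (P t f)) \<le> C * (s / t) * Lp_norm M q f"
    using assms(2) unfolding smoothing_def by blast
  have "Lp_norm M q (D s (D s (P t f))) \<le> (4 * C\<^sup>2 + 16) * (s / t)\<^sup>2 * Lp_norm M q f"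
    if f: "f \<in> Lp_space M q" and s: "0 < s" "s \<le> t" for f s t
  proof (cases "s \<le> t / 2")
    case True
    have mem: "P t f \<in> Lp_space M q" "P (t/2) f \<in> Lp_space M q" "P (t/2) (P (t/2) f) \<in> Lp_space M q"
      using q f s by (auto intro!: P_Lp)
    have "AE x in M. P t f x = P (t/2) (P (t/2) f) x"
      using P_add[of q "t/2" "t/2" f] q f s by simp
    from D_cong_AE[OF q _ _ _ this, of s]
    have "AE x in M. D s (P t f) x = D s (P (t/2) (P (t/2) f)) x"
      using mem s by simp
    moreover have "AE x in M. P (t/2) (D s (P (t/2) f)) x = D s (P (t/2) (P (t/2) f)) x"
      using q s mem by (intro P_D_commute) auto
    ultimately have "AE x in M. D s (P t f) x = P (t/2) (D s (P (t/2) f)) x"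
      by eventually_elim simp
    from D_cong_AE[OF q _ _ _ this, of s]
    have "AE x in M. D s (D s (P t f)) x = D s (P (t/2) (D s (P (t/2) f))) x"
      using q s mem by (simp add: D_Lp P_Lp)
    then have "Lp_norm M q (D s (D s (P t f))) = Lp_norm M q (D s (P (t/2) (D s (P (t/2) f))))"
      using q f s mem by (intro Lp_norm_cong_AE Lp_space_measurable[of _ M q] D_Lp P_Lp) auto
    also have "\<dots> \<le> C * (s / (t/2)) * Lp_norm M q (D s (P (t/2) f))"
      using q s mem True by (intro sm D_Lp) auto
    also have "\<dots> \<le> C * (s / (t/2)) * (C * (s / (t/2)) * Lp_norm M q f)"
      using q s f C True by (intro mult_left_mono sm) auto
    also have "\<dots> = 4 * C\<^sup>2 * (s / t)\<^sup>2 * Lp_norm M q f"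
      by (simp add: power2_eq_square)
    also have "\<dots> \<le> (4 * C\<^sup>2 + 16) * (s / t)\<^sup>2 * Lp_norm M q f"
      by (intro mult_right_mono) auto
    finally show ?thesis .
  next
    case False
    have "Lp_norm M q (D s (D s (P t f))) \<le> 2 * (2 * Lp_norm M q f)"
      using D_Lp[OF q, of s "D s (P t f)"] D_Lp[OF q, of s "P t f"] P_Lp[OF q, of t f] s f by simp
    also have "\<dots> = 4 * 1 * Lp_norm M q f"
      by simp
    also have "\<dots> \<le> (4 * C\<^sup>2 + 16) * (s / t)\<^sup>2 * Lp_norm M q f"
    proof (rule mult_right_mono)
      have "(1/2)\<^sup>2 \<le> (s / t)\<^sup>2"
        using False s by (intro power_mono) (auto simp: field_simps)
      then have "16 * (1/2)\<^sup>2 \<le> (4 * C\<^sup>2 + 16) * (s / t)\<^sup>2"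
        by (intro mult_mono) auto
      then show "4 * 1 \<le> (4 * C\<^sup>2 + 16) * (s / t)\<^sup>2"
        by (simp add: power2_eq_square)
    qed simp
    finally show ?thesis .
  qed
  then show ?thesis
    by (intro exI[of _ "4 * C\<^sup>2 + 16"]) auto
qed

text \<open>Rescale time by t: a(x) is the norm of \<open>D (t * x) (P t f)\<close>. The halving
  inequality required by \<open>marchaud_iteration\<close> is \<open>D_D\<close> solved for
  \<open>D s\<close>, with the second difference as error term.\<close>

lemma smoothing_of_second_difference:
  assumes p: "1 \<le> p" and C: "0 \<le> C"
    and second: "\<And>f s t. f \<in> Lp_space M p \<Longrightarrow> 0 < s \<Longrightarrow> s \<le> t \<Longrightarrow>
      Lp_norm M p (D s (D s (P t f))) \<le> C * (s / t) powr (3/2) * Lp_norm M p f"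
  shows "smoothing p"
  unfolding smoothing_def
proof (intro exI[of _ "4 + 3 * (C / 2)"] conjI ballI allI impI)
  fix f s t
  assume f: "f \<in> Lp_space M p" and s: "0 < s" "s \<le> (t::real)"
  let ?g = "P t f" and ?N = "Lp_norm M p f"
  have g: "?g \<in> Lp_space M p" "Lp_norm M p ?g \<le> ?N"
    using P_Lp[OF p, of t f] f s by auto
  have "Lp_norm M p (D (t * (s / t)) ?g) \<le> (4 * ?N + 3 * (C / 2 * ?N)) * (s / t)"
  proof (rule marchaud_iteration[where a = "\<lambda>x. Lp_norm M p (D (t * x) ?g)"])
    fix x :: real
    assume x: "0 < x" "x \<le> 1"
    then show "Lp_norm M p (D (t * x) ?g) \<le> 2 * ?N"
      using D_Lp[OF p _ g(1), of "t * x"] g(2) s by simp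
  next
    fix x :: real
    assume x: "0 < x" "x \<le> 1 / 2"
    then have tx: "0 < t * x" "t * x \<le> t"
      using s by auto
    have mem: "D (2 * (t * x)) ?g \<in> Lp_space M p" "D (t * x) ?g \<in> Lp_space M p"
      "D (t * x) (D (t * x) ?g) \<in> Lp_space M p"
      using p tx g by (auto intro!: D_Lp)
    have "AE y in M. D (t * x) (D (t * x) ?g) y = 2 * D (t * x) ?g y - D (2 * (t * x)) ?g y"
      using tx by (intro D_D[OF p _ g(1)]) auto
    then have "AE y in M. D (t * x) ?g y = 1/2 * D (2 * (t * x)) ?g y + 1/2 * D (t * x) (D (t * x) ?g) y"
      by eventually_elim linarith
    then have "Lp_norm M p (D (t * x) ?g)
        = Lp_norm M p (\<lambda>y. 1/2 * D (2 * (t * x)) ?g y + 1/2 * D (t * x) (D (t * x) ?g) y)"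
      using mem p by (intro Lp_norm_cong_AE Lp_space_measurable[of _ M p] Lp_lincomb) auto
    also have "\<dots> \<le> \<bar>1/2\<bar> * Lp_norm M p (D (2 * (t * x)) ?g) + \<bar>1/2\<bar> * Lp_norm M p (D (t * x) (D (t * x) ?g))"
      using mem p by (intro Lp_lincomb) auto
    also have "\<dots> \<le> \<bar>1/2\<bar> * Lp_norm M p (D (2 * (t * x)) ?g) + \<bar>1/2\<bar> * (C * (t * x / t) powr (3/2) * ?N)"
      using tx f by (intro add_left_mono mult_left_mono second) auto
    finally show "Lp_norm M p (D (t * x) ?g)
        \<le> Lp_norm M p (D (t * (2 * x)) ?g) / 2 + C / 2 * ?N * x powr (3/2)"
      using s by (simp add: mult_ac)
  qed (use s C in auto)
  then show "Lp_norm M p (D s ?g) \<le> (4 + 3 * (C / 2)) * (s / t) * ?N"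
    using s by (simp add: algebra_simps)
qed (use C in auto)

lemma D_D_P_Lp:
  assumes "1 \<le> q" "0 \<le> s" "0 \<le> t" "g \<in> Lp_space M q"
  shows "D s (D s (P t g)) \<in> Lp_space M q" "Lp_norm M q (D s (D s (P t g))) \<le> 4 * Lp_norm M q g"
  using D_Lp[OF assms(1,2), of "D s (P t g)"] D_Lp[OF assms(1,2), of "P t g"] P_Lp[OF assms(1,3,4)]
  by auto

lemma P_sum:
  assumes "1 \<le> q" "0 \<le> t" "f \<in> Lp_space M q" "g \<in> Lp_space M q"
  shows "AE x in M. P t (\<lambda>y. f y + g y) x = P t f x + P t g x"
  using P_lincomb[OF assms, of 1 1] by simp

lemma D_sum:
  assumes "1 \<le> q" "0 \<le> t" "f \<in> Lp_space M q" "g \<in> Lp_space M q"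
  shows "AE x in M. D t (\<lambda>y. f y + g y) x = D t f x + D t g x"
  using P_sum[OF assms] unfolding heat_diff_def by eventually_elim simp

text \<open>Supplies the additivity required for interpolation. Each a.e. identity has to be carried
  through the next operator by \<open>D_cong_AE\<close>.\<close>

lemma D_D_P_sum:
  assumes q: "1 \<le> q" and st: "0 \<le> s" "0 \<le> t" and fg: "f \<in> Lp_space M q" "g \<in> Lp_space M q"
  shows "AE x in M. D s (D s (P t (\<lambda>y. f y + g y))) x = D s (D s (P t f)) x + D s (D s (P t g)) x"
proof -
  note mem = P_Lp(1)[OF q] D_Lp(1)[OF q] Lp_add_space[OF _ _ q]
  have "AE x in M. D s (P t (\<lambda>y. f y + g y)) x = D s (\<lambda>x. P t f x + P t g x) x"
    using st fg by (intro D_cong_AE[OF q] P_sum[OF q] mem) auto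
  moreover have "AE x in M. D s (\<lambda>x. P t f x + P t g x) x = D s (P t f) x + D s (P t g) x"
    using st fg by (intro D_sum[OF q] mem) auto
  ultimately have *: "AE x in M. D s (P t (\<lambda>y. f y + g y)) x = D s (P t f) x + D s (P t g) x"
    by eventually_elim simp
  have "AE x in M. D s (D s (P t (\<lambda>y. f y + g y))) x = D s (\<lambda>x. D s (P t f) x + D s (P t g) x) x"
    using st fg by (intro D_cong_AE[OF q _ _ _ *] mem) auto
  moreover have "AE x in M. D s (\<lambda>x. D s (P t f) x + D s (P t g) x) x
      = D s (D s (P t f)) x + D s (D s (P t g)) x"
    using st fg by (intro D_sum[OF q] mem) auto
  ultimately show ?thesis
    by eventually_elim simp
qed

text \<open>
  The condition \<open>pq - 4q + 3p \<ge> 0\<close> says that \<open>1 - 1/p \<ge> 3/4 (1 - 1/q)\<close>: interpolating the order 2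
  on \<open>L\<^sup>q\<close> with the order 0 on \<open>L\<^sup>1\<close> then gives an order of at least \<open>3/2\<close>.
\<close>

lemma smoothing_interpolate:
  assumes p: "1 < p" "p < q" and pq: "0 \<le> p * q - 4 * q + 3 * p" and sm: "smoothing q"
  shows "smoothing p"
proof -
  have q: "1 \<le> q"
    using p by simp
  obtain K where K: "0 \<le> K" and second: "\<And>f s t. f \<in> Lp_space M q \<Longrightarrow> 0 < s \<Longrightarrow> s \<le> t \<Longrightarrow>
     Lp_norm M q (D s (D s (P t f))) \<le> K * (s / t)\<^sup>2 * Lp_norm M q f"
    using second_difference_smoothing[OF q sm] by blast
  \<comment> \<open>The interpolation constant for norm 4 on L^1 and norm
    \<open>K * e\<^sup>2\<close> on L^q, stripped of its powers of e; both of these turn out to be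
    at most \<open>e powr (3/2 * p)\<close>.\<close>
  define B where "B = p * (2 * 4) / (p - 1) + p * (2 * K) powr q / (q - p)"
  have B: "0 \<le> B"
    using p by (simp add: B_def)
  \<comment> \<open>cutting \<open>f\<close> at \<open>e powr (- r)\<close> times the level makes the contribution of \<open>L\<^sup>1\<close> exactly \<open>e powr (3/2 * p)\<close>\<close>
  define r where "r = 3 * p / (2 * (p - 1))"
  have "Lp_norm M p (D s (D s (P t f))) \<le> B powr (1 / p) * (s / t) powr (3/2) * Lp_norm M p f"
    if f: "f \<in> Lp_space M p" and s: "0 < s" "s \<le> t" for f s t
  proof -
    define e where "e = s / t"
    have e: "0 < e" "e \<le> 1"
      using s by (auto simp: e_def)
    have le: "(LINT x|M. \<bar>D s (D s (P t f)) x\<bar> powr p)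
      \<le> (p * (2 * 4) * (e powr (- r)) powr (1 - p) / (p - 1)
          + p * (2 * (K * e\<^sup>2)) powr q * (e powr (- r)) powr (q - p) / (q - p))
          * (LINT x|M. \<bar>f x\<bar> powr p)"
    proof (rule marcinkiewicz_interpolation[OF p, where A = "\<lambda>f. D s (D s (P t f))"])
      show "D s (D s (P t g)) \<in> Lp_space M 1 \<and> Lp_norm M 1 (D s (D s (P t g))) \<le> 4 * Lp_norm M 1 g"
        if "g \<in> Lp_space M 1" for g
        using D_D_P_Lp[of 1 s t g] s that by auto
      show "D s (D s (P t g)) \<in> Lp_space M q \<and> Lp_norm M q (D s (D s (P t g))) \<le> K * e\<^sup>2 * Lp_norm M q g"
        if "g \<in> Lp_space M q" for g
        using D_D_P_Lp(1)[of q s t g] second[of g s t] q s that by (auto simp: e_def)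
      show "D s (D s (P t g)) \<in> Lp_space M p" if "g \<in> Lp_space M p" for g
        using D_D_P_Lp(1)[of p s t g] p s that by auto
      show "AE x in M. D s (D s (P t (\<lambda>x. g x + h x))) x = D s (D s (P t g)) x + D s (D s (P t h)) x"
        if "g \<in> Lp_space M p" "h \<in> Lp_space M p" for g h
        using p s that by (intro D_D_P_sum[of p]) auto
    qed (use e K f in auto)
    have e1: "(e powr (- r)) powr (1 - p) = e powr (3/2 * p)"
    proof -
      have "- r * (1 - p) = r * (p - 1)"
        by (simp add: algebra_simps)
      also have "\<dots> = 3/2 * p"
        using p by (simp add: r_def field_simps)
      finally show ?thesis
        by (simp only: powr_powr)
    qed
    have e2: "(2 * (K * e\<^sup>2)) powr q * (e powr (- r)) powr (q - p) \<le> (2 * K) powr q * e powr (3/2 * p)"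
    proof -
      have "(2 * (K * e\<^sup>2)) powr q * (e powr (- r)) powr (q - p) = (2 * K) powr q * e powr (2 * q - r * (q - p))"
      proof -
        have "(e\<^sup>2) powr q = e powr (2 * q)"
          using e powr_powr[of e 2 q] by simp
        moreover have "(e powr (- r)) powr (q - p) = e powr (- (r * (q - p)))"
          by (simp add: powr_powr)
        moreover have "e powr (2 * q) * e powr (- (r * (q - p))) = e powr (2 * q - r * (q - p))"
          by (simp only: powr_add[symmetric] diff_conv_add_uminus)
        ultimately show ?thesis
          by (simp only: powr_mult mult.assoc)
      qed
      \<comment> \<open>Here the hypothesis on p and q enters; since e <= 1, a larger exponent gives
        a smaller power. The comparison of exponents only feeds the following fact, and it is that
        bound on the power of e which \<open>finally\<close> chains.\<close>
      also have "3/2 * p \<le> 2 * q - r * (q - p)"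
      proof -
        have "2 * q - r * (q - p) - 3/2 * p = (p * q - 4 * q + 3 * p) / (2 * (p - 1))"
          using p by (simp add: r_def field_simps)
        moreover have "0 \<le> (p * q - 4 * q + 3 * p) / (2 * (p - 1))"
          using p pq by simp
        ultimately show ?thesis
          by simp
      qed
      then have "e powr (2 * q - r * (q - p)) \<le> e powr (3/2 * p)"
        using e by (intro powr_mono') auto
      finally show ?thesis
        by (simp add: mult_left_mono)
    qed
    have "p * (2 * (K * e\<^sup>2)) powr q * (e powr (- r)) powr (q - p) / (q - p)
        \<le> p * (2 * K) powr q / (q - p) * e powr (3/2 * p)"
      using mult_left_mono[OF e2, of "p / (q - p)"] p by (simp add: mult_ac)
    then have "(LINT x|M. \<bar>D s (D s (P t f)) x\<bar> powr p) \<le> B * e powr (3/2 * p) * (LINT x|M. \<bar>f x\<bar> powr p)"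
      by (intro order_trans[OF le] mult_right_mono) (auto simp: e1 B_def distrib_right)
    also have "\<dots> = (B powr (1 / p) * e powr (3/2) * Lp_norm M p f) powr p"
      using p B by (simp add: powr_mult powr_powr Lp_norm_powr)
    finally show ?thesis
      using p by (subst Lp_norm_le_iff) (auto simp: e_def)
  qed
  then show ?thesis
    using p by (intro smoothing_of_second_difference[of p "B powr (1 / p)"]) auto
qed

text \<open>Descent from exponent 2: one interpolation step can shrink the distance of the exponent
  to 1 by the factor 3/4, so finitely many steps reach every p > 1.\<close>

theorem smoothing_Lp:
  assumes "1 < p" "p \<le> 2"
  shows "smoothing p"
proof -
  have two: "smoothing 2"
    unfolding smoothing_def using L2_smoothing by (intro exI[of _ 2]) auto
  have "smoothing p" if "(3/4) ^ n \<le> p - 1" "p \<le> 2" "1 < p" for n p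
    using that
  proof (induction n arbitrary: p)
    case 0
    then have "p = 2"
      by simp
    then show ?case
      using two by simp
  next
    case (Suc n)
    \<comment> \<open>8/5 is the exponent for which q = 2 makes the interpolation condition an
      equality; from there upwards a single step from 2 suffices.\<close>
    consider "p = 2" | "p < 2" "8 / 5 \<le> p" | "p < 8 / 5"
      using Suc.prems by linarith
    then show ?case
    proof cases
      case 1
      then show ?thesis
        using two by simp
    next
      case 2
      then show ?thesis
        using Suc.prems by (intro smoothing_interpolate[of p 2] two) auto
    next
      case 3
      \<comment> \<open>The solution of pq - 4q + 3p = 0. It satisfies q - 1 = 4 (p - 1) / (4 - p),
        and 4 - p < 3 gives the gain 4/3.\<close>
      define q where "q = 3 * p / (4 - p)"
      have "4 / 3 * (p - 1) \<le> q - 1"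
      proof -
        have "q - 1 = 4 * (p - 1) / (4 - p)"
          using 3 by (simp add: q_def field_simps)
        moreover have "4 * (p - 1) / 3 \<le> 4 * (p - 1) / (4 - p)"
          using 3 Suc.prems by (intro divide_left_mono) auto
        ultimately show ?thesis
          by simp
      qed
      moreover have "(3/4) ^ n \<le> 4 / 3 * (p - 1)"
        using Suc.prems by simp
      ultimately have "(3/4) ^ n \<le> q - 1"
        by simp
      moreover have "q \<le> 2" "p < q"
        using 3 Suc.prems by (auto simp: q_def field_simps)
      ultimately have "smoothing q"
        using Suc.prems by (intro Suc.IH) auto
      moreover have "p * q - 4 * q + 3 * p = 0"
      proof -
        have "q * (4 - p) = 3 * p"
          using 3 by (simp add: q_def)
        then show ?thesis
          by (simp add: algebra_simps)
      qed
      ultimately show ?thesis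
        using Suc.prems \<open>p < q\<close> by (intro smoothing_interpolate[of p q]) auto
    qed
  qed
  moreover obtain n where "(3/4) ^ n < p - 1"
    using real_arch_pow_inv[of "p - 1" "3/4"] assms by auto
  ultimately show ?thesis
    using assms less_imp_le by blast
qed

end

section \<open>A pointwise inequality for signed powers\<close>

text \<open>With exponent p - 1 this is the duality map of L^p up to normalisation: its product with
  x is |x|^p.\<close>

definition signed_powr :: "real \<Rightarrow> real \<Rightarrow> real" where
  "signed_powr x r = sgn x * \<bar>x\<bar> powr r"

lemma signed_powr_minus [simp]: "signed_powr (- x) r = - signed_powr x r"
  by (simp add: signed_powr_def)

lemma signed_powr_nonneg: "0 \<le> x \<Longrightarrow> signed_powr x r = x powr r"
  by (auto simp: signed_powr_def sgn_if)

lemma abs_signed_powr: "\<bar>signed_powr x r\<bar> = \<bar>x\<bar> powr r"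
  by (auto simp: signed_powr_def abs_mult sgn_if)

lemma mult_signed_powr: "x * signed_powr x (p - 1) = \<bar>x\<bar> powr p"
proof (cases "x = 0")
  case False
  have "x * signed_powr x (p - 1) = \<bar>x\<bar> powr 1 * \<bar>x\<bar> powr (p - 1)"
    by (simp add: signed_powr_def sgn_if)
  then show ?thesis
    unfolding powr_add[symmetric] by simp
qed (simp add: signed_powr_def)

text \<open>A concave power lies below its tangent at a. This is Young's inequality for b^r a^(1-r),
  multiplied by a^(r-1).\<close>

lemma powr_tangent:
  fixes a b r :: real
  assumes "0 < r" "r \<le> 1" "0 < a" "0 \<le> b"
  shows "b powr r \<le> a powr r + r * a powr (r - 1) * (b - a)"
proof (cases "b = 0")
  case True
  have "r * a powr (r - 1) * a = r * a powr r"
    using assms by (simp add: powr_diff)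
  also have "\<dots> \<le> 1 * a powr r"
    using assms by (intro mult_right_mono) auto
  finally show ?thesis
    using True by simp
next
  case False
  have "b powr r * a powr (1 - r) \<le> r * b + (1 - r) * a"
    using assms False by (intro Youngs_inequality_0) auto
  then have "b powr r * a powr (1 - r) * a powr (r - 1) \<le> (r * b + (1 - r) * a) * a powr (r - 1)"
    by (intro mult_right_mono) auto
  moreover have "b powr r * a powr (1 - r) * a powr (r - 1) = b powr r"
    using assms by (simp add: mult.assoc powr_add[symmetric])
  moreover have "(r * b + (1 - r) * a) * a powr (r - 1)
      = a * a powr (r - 1) + r * a powr (r - 1) * (b - a)"
    by (simp add: algebra_simps)
  moreover have "a * a powr (r - 1) = a powr r"
    using assms by (simp add: powr_diff)
  ultimately show ?thesis
    by simp
qed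

text \<open>Split at a - b = sqrt e * a. Below this threshold the second term suffices. Above it, p
  <= 2 bounds (a - b)^(p-2) by (sqrt e * a)^(p-2), and the tangent inequality bounds the remaining
  a^(p-2) (a - b) by the difference of powers. This gives 1 / (p - 1); the factor 2 serves to match
  the case of opposite signs.\<close>

lemma diff_powr_le_same_sign:
  fixes a b p e :: real
  assumes p: "1 < p" "p \<le> 2" and e: "0 < e" and ab: "0 \<le> b" "b \<le> a"
  shows "(a - b) powr p \<le> 2 / (p - 1) * e powr (p / 2 - 1) * ((a - b) * (a powr (p - 1) - b powr (p - 1)))
    + e powr (p / 2) * (a powr p + b powr p)"
proof -
  have mono: "b powr (p - 1) \<le> a powr (p - 1)"
    using p ab by (intro powr_mono2) auto
  have nonneg: "0 \<le> 2 / (p - 1) * e powr (p / 2 - 1) * ((a - b) * (a powr (p - 1) - b powr (p - 1)))"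
    using p ab mono by (intro mult_nonneg_nonneg) auto
  show ?thesis
  proof (cases "a - b \<le> sqrt e * a")
    case True
    have "(a - b) powr p \<le> (sqrt e * a) powr p"
      using True p ab by (intro powr_mono2) auto
    also have "\<dots> = e powr (p / 2) * a powr p"
      using e by (simp add: powr_mult powr_powr powr_half_sqrt[symmetric])
    also have "\<dots> \<le> e powr (p / 2) * (a powr p + b powr p)"
      by (intro mult_left_mono) auto
    finally show ?thesis
      using nonneg by simp
  next
    case False
    have a: "0 < a" "b < a"
    proof -
      have "0 \<le> sqrt e * a"
        using e ab by simp
      then show "b < a"
        using False by simp
      then show "0 < a"
        using ab by simp
    qed
    have "(a - b) powr p = (a - b)\<^sup>2 * (a - b) powr (p - 2)"
      using a by (simp add: powr_diff)
    also have "\<dots> \<le> (a - b)\<^sup>2 * (sqrt e * a) powr (p - 2)"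
      using False a e p by (intro mult_left_mono powr_mono2') auto
    also have "(sqrt e * a) powr (p - 2) = e powr (p / 2 - 1) * a powr (p - 2)"
      using e by (simp add: powr_mult powr_powr powr_half_sqrt[symmetric] field_simps)
    also have "(a - b)\<^sup>2 * (e powr (p / 2 - 1) * a powr (p - 2))
        = e powr (p / 2 - 1) * ((a - b) * (a powr (p - 2) * (a - b)))"
      by (simp add: power2_eq_square mult_ac)
    also have "\<dots> \<le> e powr (p / 2 - 1) * ((a - b) * (1 / (p - 1) * (a powr (p - 1) - b powr (p - 1))))"
    proof (intro mult_left_mono)
      have "b powr (p - 1) \<le> a powr (p - 1) + (p - 1) * a powr (p - 2) * (b - a)"
        using powr_tangent[of "p - 1" a b] p a ab by simp
      then have "(p - 1) * (a powr (p - 2) * (a - b)) \<le> a powr (p - 1) - b powr (p - 1)"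
        by (simp add: algebra_simps)
      then show "a powr (p - 2) * (a - b) \<le> 1 / (p - 1) * (a powr (p - 1) - b powr (p - 1))"
        using p by (simp add: field_simps)
    qed (use a in auto)
    also have "\<dots> \<le> 2 / (p - 1) * e powr (p / 2 - 1) * ((a - b) * (a powr (p - 1) - b powr (p - 1)))"
    proof -
      have "0 \<le> 1 / (p - 1) * e powr (p / 2 - 1) * ((a - b) * (a powr (p - 1) - b powr (p - 1)))"
        using p ab mono by (intro mult_nonneg_nonneg) auto
      moreover have "e powr (p / 2 - 1) * ((a - b) * (1 / (p - 1) * (a powr (p - 1) - b powr (p - 1))))
          = 1 / (p - 1) * e powr (p / 2 - 1) * ((a - b) * (a powr (p - 1) - b powr (p - 1)))"
        by (simp only: mult_ac)
      moreover have "2 / (p - 1) * e powr (p / 2 - 1) * ((a - b) * (a powr (p - 1) - b powr (p - 1)))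
          = 2 * (1 / (p - 1) * e powr (p / 2 - 1) * ((a - b) * (a powr (p - 1) - b powr (p - 1))))"
        by simp
      ultimately show ?thesis
        by linarith
    qed
    finally show ?thesis
      using e by (simp add: add_increasing2)
  qed
qed

text \<open>Without cancellation the first term alone suffices: (a + b)^(p-1) is at most 2 a^(p-1),
  and e <= 1 together with p <= 2 makes both 1 / (p - 1) and the power of e at least 1.\<close>

lemma diff_powr_le_opposite_sign:
  fixes a b p e :: real
  assumes p: "1 < p" "p \<le> 2" and e: "0 < e" "e \<le> 1" and ab: "0 \<le> b" "b \<le> a"
  shows "(a + b) powr p \<le> 2 / (p - 1) * e powr (p / 2 - 1) * ((a + b) * (a powr (p - 1) + b powr (p - 1)))"
proof (cases "a = 0")
  case False
  then have a: "0 < a + b"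
    using ab by simp
  have "(a + b) powr p = (a + b) * (a + b) powr (p - 1)"
    using a by (simp add: powr_diff)
  also have "\<dots> \<le> (a + b) * (2 * a) powr (p - 1)"
    using p ab by (intro mult_left_mono powr_mono2) auto
  also have "(2 * a) powr (p - 1) = 2 powr (p - 1) * a powr (p - 1)"
    by (rule powr_mult)
  also have "(a + b) * \<dots> \<le> (a + b) * (2 * (a powr (p - 1) + b powr (p - 1)))"
    using p ab powr_mono[of "p - 1" 1 "2::real"] by (intro mult_left_mono mult_mono) auto
  also have "\<dots> = 2 * ((a + b) * (a powr (p - 1) + b powr (p - 1)))"
    by simp
  also have "\<dots> \<le> 2 / (p - 1) * e powr (p / 2 - 1) * ((a + b) * (a powr (p - 1) + b powr (p - 1)))"
  proof (rule mult_right_mono)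
    have "1 \<le> e powr (p / 2 - 1)"
      using powr_mono'[of "p / 2 - 1" 0 e] e p by simp
    moreover have "2 \<le> 2 / (p - 1)"
      using p by (simp add: field_simps)
    ultimately have "2 * 1 \<le> 2 / (p - 1) * e powr (p / 2 - 1)"
      using p by (intro mult_mono) auto
    then show "2 \<le> 2 / (p - 1) * e powr (p / 2 - 1)"
      by simp
  qed (use ab in auto)
  finally show ?thesis .
qed (use ab in auto)

text \<open>Both sides are invariant under exchanging a and b and under negating both, which reduces
  the eight sectors of the plane to the two previous lemmas.\<close>

lemma diff_powr_le:
  fixes a b p e :: real
  assumes p: "1 < p" "p \<le> 2" and e: "0 < e" "e \<le> 1"
  shows "\<bar>a - b\<bar> powr p
    \<le> 2 / (p - 1) * e powr (p / 2 - 1) * ((a - b) * (signed_powr a (p - 1) - signed_powr b (p - 1)))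
      + e powr (p / 2) * (\<bar>a\<bar> powr p + \<bar>b\<bar> powr p)"
proof -
  let ?claim = "\<lambda>a b. \<bar>a - b\<bar> powr p
    \<le> 2 / (p - 1) * e powr (p / 2 - 1) * ((a - b) * (signed_powr a (p - 1) - signed_powr b (p - 1)))
      + e powr (p / 2) * (\<bar>a\<bar> powr p + \<bar>b\<bar> powr p)"
  have swap: "?claim a b" if "?claim b a" for a b
  proof -
    have "(a - b) * (signed_powr a (p - 1) - signed_powr b (p - 1))
      = (b - a) * (signed_powr b (p - 1) - signed_powr a (p - 1))"
      by (simp add: algebra_simps)
    then show ?thesis
      using that by (simp only: abs_minus_commute[of a b] add.commute[of "\<bar>a\<bar> powr p"])
  qed
  have neg: "?claim a b" if "?claim (- a) (- b)" for a b
  proof -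
    have "(- a - - b) * (signed_powr (- a) (p - 1) - signed_powr (- b) (p - 1))
      = (a - b) * (signed_powr a (p - 1) - signed_powr b (p - 1))"
      by (simp add: algebra_simps)
    moreover have "\<bar>- a - - b\<bar> = \<bar>a - b\<bar>"
      by simp
    ultimately show ?thesis
      using that by (simp only: abs_minus_cancel)
  qed
  have same: "?claim a b" if "0 \<le> b" "b \<le> a" for a b
    using diff_powr_le_same_sign[OF p e(1) that] that by (simp add: signed_powr_nonneg)
  have opp: "?claim a (- b)" if "0 \<le> b" "b \<le> a" for a b
    using diff_powr_le_opposite_sign[OF p e that] that
    by (simp add: signed_powr_nonneg add_increasing2)
  consider "0 \<le> b" "b \<le> a" | "0 \<le> a" "a \<le> b" | "b \<le> 0" "a \<le> b" | "a \<le> 0" "b \<le> a"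
    | "b \<le> 0" "- b \<le> a" | "b \<le> 0" "0 \<le> a" "a \<le> - b" | "a \<le> 0" "- a \<le> b" | "a \<le> 0" "0 \<le> b" "b \<le> - a"
    by linarith
  then show ?thesis
  proof cases
    case 1
    then show ?thesis
      by (rule same)
  next
    case 2
    then show ?thesis
      by (rule swap[OF same])
  next
    case 3
    show ?thesis
      by (rule neg[OF same]) (use 3 in auto)
  next
    case 4
    show ?thesis
      by (rule neg[OF swap[OF same]]) (use 4 in auto)
  next
    case 5
    then show ?thesis
      using opp[of "- b" a] by simp
  next
    case 6
    then have "?claim (- b) (- a)"
      by (intro opp) auto
    then show ?thesis
      by (rule neg[OF swap])
  next
    case 7
    then have "?claim b (- (- a))"
      by (intro opp) auto
    then show ?thesis
      unfolding minus_minus by (rule swap)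
  next
    case 8
    then have "?claim (- a) (- b)"
      by (intro opp) auto
    then show ?thesis
      by (rule neg)
  qed
qed

section \<open>The heat kernel and its joint measure\<close>

text \<open>Fatou's lemma for |w n - v|^q: the pointwise limit |h - v|^q has integral 0.\<close>

lemma Lp_tendsto_AE_unique:
  assumes w: "\<And>n. w n \<in> Lp_space M q" and v: "v \<in> Lp_space M q" and q: "0 < q"
    and conv: "(\<lambda>n. Lp_norm M q (\<lambda>x. w n x - v x)) \<longlonglongrightarrow> 0"
    and diff: "\<And>n. (\<lambda>x. w n x - v x) \<in> Lp_space M q"
    and pointwise: "AE x in M. (\<lambda>n. w n x) \<longlonglongrightarrow> h x"
  shows "AE x in M. v x = h x"
proof -
  have [measurable]: "w n \<in> borel_measurable M" "v \<in> borel_measurable M" for n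
    using w v by auto
  have "(\<integral>\<^sup>+x. liminf (\<lambda>n. ennreal (\<bar>w n x - v x\<bar> powr q)) \<partial>M)
      \<le> liminf (\<lambda>n. \<integral>\<^sup>+x. ennreal (\<bar>w n x - v x\<bar> powr q) \<partial>M)"
    by (intro nn_integral_liminf) measurable
  also have "\<dots> = liminf (\<lambda>n. ennreal (Lp_norm M q (\<lambda>x. w n x - v x) powr q))"
    using diff q by (simp add: nn_integral_Lp)
  also have "\<dots> = 0"
  proof (rule lim_imp_Liminf)
    have "(\<lambda>n. Lp_norm M q (\<lambda>x. w n x - v x) powr q) \<longlonglongrightarrow> 0 powr q"
      using conv q by (intro tendsto_powr') auto
    then show "(\<lambda>n. ennreal (Lp_norm M q (\<lambda>x. w n x - v x) powr q)) \<longlonglongrightarrow> 0"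
      using q tendsto_ennrealI by fastforce
  qed simp
  finally have "AE x in M. liminf (\<lambda>n. ennreal (\<bar>w n x - v x\<bar> powr q)) = 0"
    by (subst (asm) le_zero_eq, subst (asm) nn_integral_0_iff_AE) auto
  with pointwise show ?thesis
  proof eventually_elim
    case (elim x)
    have "(\<lambda>n. \<bar>w n x - v x\<bar> powr q) \<longlonglongrightarrow> \<bar>h x - v x\<bar> powr q"
      using q by (intro tendsto_powr' tendsto_intros elim) auto
    then have "(\<lambda>n. ennreal (\<bar>w n x - v x\<bar> powr q)) \<longlonglongrightarrow> ennreal (\<bar>h x - v x\<bar> powr q)"
      by (rule tendsto_ennrealI)
    then have "liminf (\<lambda>n. ennreal (\<bar>w n x - v x\<bar> powr q)) = ennreal (\<bar>h x - v x\<bar> powr q)"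
      by (rule lim_imp_Liminf[rotated]) simp
    then have "ennreal (\<bar>h x - v x\<bar> powr q) = 0"
      using elim by simp
    then show "v x = h x"
      by (simp add: ennreal_eq_0_iff)
  qed
qed

text \<open>Bounded approximants, used to pass from the kernel representation on bounded functions
  to L^q. Domination by |v| gives convergence in norm.\<close>

lemma Lp_truncation:
  fixes v :: "'a \<Rightarrow> real"
  assumes v: "v \<in> Lp_space M q" and q: "1 \<le> q"
  defines "w \<equiv> \<lambda>(n::nat) x. max (- real n) (min (real n) (v x))"
  shows "w n \<in> Lp_space M q" "(\<lambda>n. Lp_norm M q (\<lambda>x. w n x - v x)) \<longlonglongrightarrow> 0"
    "\<bar>w n x\<bar> \<le> real n" "\<bar>w n x\<bar> \<le> \<bar>v x\<bar>" "(\<lambda>n. w n x) \<longlonglongrightarrow> v x"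
proof -
  have [measurable]: "v \<in> borel_measurable M"
    using v by auto
  have int: "integrable M (\<lambda>x. \<bar>v x\<bar> powr q)"
    using v by (simp add: Lp_space_def)
  have le: "\<bar>w n x\<bar> \<le> \<bar>v x\<bar>" for n x
    by (auto simp: w_def)
  show "\<bar>w n x\<bar> \<le> \<bar>v x\<bar>"
    by (rule le)
  show "\<bar>w n x\<bar> \<le> real n"
    by (auto simp: w_def)
  have [measurable]: "w n \<in> borel_measurable M" for n
    unfolding w_def by measurable
  have diff_le: "\<bar>w n x - v x\<bar> \<le> \<bar>v x\<bar>" for n x
    by (auto simp: w_def)
  have conv: "(\<lambda>n. w n x) \<longlonglongrightarrow> v x" for x
  proof (rule tendsto_eventually)
    obtain N :: nat where "\<bar>v x\<bar> \<le> real N"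
      using real_arch_simple by blast
    then show "\<forall>\<^sub>F n in sequentially. w n x = v x"
      unfolding eventually_sequentially w_def by (intro exI[of _ N]) auto
  qed
  then show "(\<lambda>n. w n x) \<longlonglongrightarrow> v x" .
  have "integrable M (\<lambda>x. \<bar>w n x\<bar> powr q)"
    by (rule Bochner_Integration.integrable_bound[OF int])
      (use le q in \<open>auto intro!: AE_I2 powr_mono2\<close>)
  then show "w n \<in> Lp_space M q"
    by (simp add: Lp_space_def)
  have "(\<lambda>n. LINT x|M. \<bar>w n x - v x\<bar> powr q) \<longlonglongrightarrow> (LINT x|M. 0)"
  proof (rule integral_dominated_convergence[OF _ _ int])
    show "AE x in M. (\<lambda>n. \<bar>w n x - v x\<bar> powr q) \<longlonglongrightarrow> 0"
    proof (rule AE_I2)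
      fix x
      have "(\<lambda>n. \<bar>w n x - v x\<bar> powr q) \<longlonglongrightarrow> \<bar>v x - v x\<bar> powr q"
        using q by (intro tendsto_powr' tendsto_intros conv) auto
      then show "(\<lambda>n. \<bar>w n x - v x\<bar> powr q) \<longlonglongrightarrow> 0"
        using q by simp
    qed
    show "AE x in M. norm (\<bar>w n x - v x\<bar> powr q) \<le> \<bar>v x\<bar> powr q" for n
      using diff_le q by (auto intro!: AE_I2 powr_mono2)
  qed auto
  then have "(\<lambda>n. (LINT x|M. \<bar>w n x - v x\<bar> powr q) powr (1 / q)) \<longlonglongrightarrow> 0 powr (1 / q)"
    using q by (intro tendsto_powr') auto
  then show "(\<lambda>n. Lp_norm M q (\<lambda>x. w n x - v x)) \<longlonglongrightarrow> 0"
    using q by (simp add: Lp_norm_def)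
qed

section \<open>Kernels and the joint measure on pairs\<close>

locale heat_kernel_semigroup = heat_semigroup M \<E> \<F> P
  for M :: "'a measure" and \<E> \<F> P +
  fixes k :: "real \<Rightarrow> 'a \<Rightarrow> 'a measure"
  assumes kernel: "heat_kernel M P k"
begin

lemma kernel_measurable [measurable]: "0 < s \<Longrightarrow> k s \<in> M \<rightarrow>\<^sub>M prob_algebra M"
  using kernel by (auto simp: heat_kernel_def)

lemma
  assumes "0 < s" "y \<in> space M"
  shows prob_space_kernel: "prob_space (k s y)" and sets_kernel: "sets (k s y) = sets M"
  using measurable_space[OF kernel_measurable[OF assms(1)] assms(2)]
  by (auto simp: space_prob_algebra)

lemma kernel_rep_bounded:
  assumes "0 < s" "f \<in> borel_measurable M" "\<And>x. x \<in> space M \<Longrightarrow> \<bar>f x\<bar> \<le> c"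
  shows "AE x in M. P s f x = (LINT y|k s x. f y)"
  using kernel assms unfolding heat_kernel_def by blast

text \<open>The symmetric measure \<open>p\<^sub>s(y, dx) \<mu>(dy)\<close> on pairs \<open>(x, y)\<close>.\<close>

definition joint :: "real \<Rightarrow> ('a \<times> 'a) measure" where
  "joint s = M \<bind> (\<lambda>y. distr (k s y) (M \<Otimes>\<^sub>M M) (\<lambda>x. (x, y)))"

lemma joint_kernel_measurable:
  assumes "0 < s"
  shows "(\<lambda>y. distr (k s y) (M \<Otimes>\<^sub>M M) (\<lambda>x. (x, y))) \<in> M \<rightarrow>\<^sub>M subprob_algebra (M \<Otimes>\<^sub>M M)"
  by (rule measurable_distr2[where M = M])
    (use measurable_prob_algebraD[OF kernel_measurable[OF assms]] in \<open>auto simp: split_beta'\<close>)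

lemma sets_joint [simp, measurable_cong]:
  assumes "0 < s"
  shows "sets (joint s) = sets (M \<Otimes>\<^sub>M M)"
\<comment> \<open>\<open>bind\<close> takes a default value on an empty space, so there both
  \<sigma>-algebras are computed directly.\<close>
proof (cases "space M = {}")
  case True
  then have "space (M \<Otimes>\<^sub>M M) = {}"
    by (simp add: space_pair_measure)
  then have "sets (M \<Otimes>\<^sub>M M) = {{}}"
    using sets.sets_into_space[of _ "M \<Otimes>\<^sub>M M"] sets.empty_sets[of "M \<Otimes>\<^sub>M M"] by auto
  moreover have "sets M = {{}}"
    using sets.sets_into_space[of _ M] sets.empty_sets[of M] True by auto
  ultimately show ?thesis
    by (simp add: joint_def True sets_bind_empty bind_empty)
next
  case False
  then show ?thesis
    unfolding joint_def by (intro sets_bind) auto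
qed

lemma nn_integral_joint:
  assumes s: "0 < s" and F [measurable]: "F \<in> borel_measurable (M \<Otimes>\<^sub>M M)"
  shows "(\<integral>\<^sup>+z. F z \<partial>joint s) = (\<integral>\<^sup>+y. (\<integral>\<^sup>+x. F (x, y) \<partial>k s y) \<partial>M)"
proof -
  have "(\<integral>\<^sup>+z. F z \<partial>joint s)
      = (\<integral>\<^sup>+y. \<integral>\<^sup>+z. F z \<partial>distr (k s y) (M \<Otimes>\<^sub>M M) (\<lambda>x. (x, y)) \<partial>M)"
    unfolding joint_def by (rule nn_integral_bind[OF F joint_kernel_measurable[OF s]])
  also have "\<dots> = (\<integral>\<^sup>+y. (\<integral>\<^sup>+x. F (x, y) \<partial>k s y) \<partial>M)"
  proof (rule nn_integral_cong)
    fix y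
    assume y: "y \<in> space M"
    have "(\<lambda>x. (x, y)) \<in> k s y \<rightarrow>\<^sub>M M \<Otimes>\<^sub>M M"
      using y by (simp cong: measurable_cong_sets add: sets_kernel[OF s y])
    then show "(\<integral>\<^sup>+z. F z \<partial>distr (k s y) (M \<Otimes>\<^sub>M M) (\<lambda>x. (x, y))) = (\<integral>\<^sup>+x. F (x, y) \<partial>k s y)"
      by (intro nn_integral_distr) auto
  qed
  finally show ?thesis .
qed

section \<open>Symmetry of the joint measure\<close>

lemma emeasure_joint_rectangle:
  assumes s: "0 < s" and [measurable]: "A \<in> sets M" "B \<in> sets M"
  shows "emeasure (joint s) (A \<times> B) = (\<integral>\<^sup>+y. emeasure (k s y) A * indicator B y \<partial>M)"
proof -
  have "emeasure (joint s) (A \<times> B) = (\<integral>\<^sup>+z. indicator (A \<times> B) z \<partial>joint s)"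
    using s by (intro nn_integral_indicator[symmetric]) auto
  also have "\<dots> = (\<integral>\<^sup>+y. (\<integral>\<^sup>+x. indicator (A \<times> B) (x, y) \<partial>k s y) \<partial>M)"
    using s by (intro nn_integral_joint) auto
  also have "\<dots> = (\<integral>\<^sup>+y. emeasure (k s y) A * indicator B y \<partial>M)"
  proof (rule nn_integral_cong)
    fix y
    assume y: "y \<in> space M"
    have "(\<integral>\<^sup>+x. indicator (A \<times> B) (x, y) \<partial>k s y) = (\<integral>\<^sup>+x. indicator A x * indicator B y \<partial>k s y)"
      by (intro nn_integral_cong) (auto simp: indicator_def)
    also have "\<dots> = emeasure (k s y) A * indicator B y"
      using sets_kernel[OF s y] by (subst nn_integral_multc) auto
    finally show "(\<integral>\<^sup>+x. indicator (A \<times> B) (x, y) \<partial>k s y) = emeasure (k s y) A * indicator B y" .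
  qed
  finally show ?thesis .
qed

lemma indicator_L2:
  assumes "A \<in> sets M" "emeasure M A < \<infinity>"
  shows "(indicator A :: 'a \<Rightarrow> real) \<in> Lp_space M 2"
proof -
  have "(\<lambda>x. \<bar>indicator A x :: real\<bar> powr 2) = indicator A"
    by (auto simp: indicator_def)
  then show ?thesis
    using assms by (simp add: Lp_space_def less_top)
qed

text \<open>Finite measure puts the indicators into L^2, where self-adjointness is available; the
  bounded kernel representation identifies P_s of an indicator with the kernel mass.\<close>

lemma emeasure_joint_finite_rectangle:
  assumes s: "0 < s" and A [measurable]: "A \<in> sets M" "emeasure M A < \<infinity>"
    and B [measurable]: "B \<in> sets M" "emeasure M B < \<infinity>"
  shows "emeasure (joint s) (A \<times> B) = ennreal (L2_inner M (P s (indicator A)) (indicator B))"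
proof -
  note AB = indicator_L2[OF A] indicator_L2[OF B]
  have rep: "AE y in M. P s (indicator A) y = measure (k s y) A"
  proof -
    have "AE y in M. P s (indicator A) y = (LINT x|k s y. indicator A x)"
      by (rule kernel_rep_bounded[OF s, where c = 1]) (auto simp: indicator_def)
    with AE_space show ?thesis
    proof eventually_elim
      case (elim y)
      have "A \<in> sets (k s y)"
        using sets_kernel[OF s] elim by simp
      then show ?case
        using elim by simp
    qed
  qed
  have "emeasure (joint s) (A \<times> B) = (\<integral>\<^sup>+y. emeasure (k s y) A * indicator B y \<partial>M)"
    using s by (intro emeasure_joint_rectangle) auto
  also have "\<dots> = (\<integral>\<^sup>+y. ennreal (P s (indicator A) y * indicator B y) \<partial>M)"
  proof (rule nn_integral_cong_AE, use rep AE_space in eventually_elim)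
    case (elim y)
    interpret prob_space "k s y"
      using prob_space_kernel[OF s] elim by simp
    show ?case
      using elim by (simp add: emeasure_eq_measure ennreal_mult'' indicator_def)
  qed
  also have "\<dots> = ennreal (LINT y|M. P s (indicator A) y * indicator B y)"
  proof (rule nn_integral_eq_integral)
    show "integrable M (\<lambda>y. P s (indicator A) y * indicator B y)"
      using AB s by (intro L2_integrable_mult P_Lp) auto
    show "AE y in M. 0 \<le> P s (indicator A) y * indicator B y"
      using rep by eventually_elim simp
  qed
  finally show ?thesis
    by (simp add: L2_inner_def)
qed

text \<open>For sets of finite measure this is self-adjointness of P_s. In general both factors are
  cut with the same member of an increasing exhaustion, so that the smaller rectangles increase to
  the full one.\<close>

lemma emeasure_joint_swap:
  assumes s: "0 < s" and [measurable]: "A \<in> sets M" "B \<in> sets M"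
  shows "emeasure (joint s) (A \<times> B) = emeasure (joint s) (B \<times> A)"
proof -
  obtain X :: "nat \<Rightarrow> 'a set" where X: "range X \<subseteq> sets M" "(\<Union>i. X i) = space M"
      "\<And>i. emeasure M (X i) \<noteq> \<infinity>" "incseq X"
    using sigma_finite_incseq by blast
  have [measurable]: "X i \<in> sets M" for i
    using X by auto
  have fin: "emeasure M (S \<inter> X i) < \<infinity>" if [measurable]: "S \<in> sets M" for S i
    using emeasure_mono[of "S \<inter> X i" "X i" M] X(3)[of i]
    by (auto simp: less_top top.not_eq_extremum intro: le_less_trans)
  have sup: "emeasure (joint s) (S \<times> T) = (SUP i. emeasure (joint s) ((S \<inter> X i) \<times> (T \<inter> X i)))"
    if [measurable]: "S \<in> sets M" "T \<in> sets M" for S T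
  proof -
    have "S \<times> T = (\<Union>i. (S \<inter> X i) \<times> (T \<inter> X i))"
    proof (intro equalityI subsetI)
      fix z
      assume z: "z \<in> S \<times> T"
      then have "fst z \<in> (\<Union>i. X i)" "snd z \<in> (\<Union>i. X i)"
        using sets.sets_into_space[OF that(1)] sets.sets_into_space[OF that(2)] X(2) by auto
      then obtain i j where "fst z \<in> X i" "snd z \<in> X j"
        by blast
      then have "fst z \<in> X (max i j)" "snd z \<in> X (max i j)"
        using incseqD[OF X(4), of i "max i j"] incseqD[OF X(4), of j "max i j"] by auto
      then show "z \<in> (\<Union>i. (S \<inter> X i) \<times> (T \<inter> X i))"
        using z by (auto simp: mem_Times_iff)
    qed auto
    moreover have "(SUP i. emeasure (joint s) ((S \<inter> X i) \<times> (T \<inter> X i)))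
        = emeasure (joint s) (\<Union>i. (S \<inter> X i) \<times> (T \<inter> X i))"
    proof (rule SUP_emeasure_incseq)
      show "range (\<lambda>i. (S \<inter> X i) \<times> (T \<inter> X i)) \<subseteq> sets (joint s)"
        using s by auto
      show "incseq (\<lambda>i. (S \<inter> X i) \<times> (T \<inter> X i))"
        using X(4) by (auto simp: incseq_def subset_eq)
    qed
    ultimately show ?thesis
      by simp
  qed
  have "emeasure (joint s) ((A \<inter> X i) \<times> (B \<inter> X i)) = emeasure (joint s) ((B \<inter> X i) \<times> (A \<inter> X i))" for i
  proof -
    have mem: "A \<inter> X i \<in> sets M" "B \<inter> X i \<in> sets M"
      by auto
    note L2 = indicator_L2[OF mem(1) fin] indicator_L2[OF mem(2) fin]
    have "L2_inner M (P s (indicator (A \<inter> X i))) (indicator (B \<inter> X i))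
      = L2_inner M (P s (indicator (B \<inter> X i))) (indicator (A \<inter> X i))"
      using self_adjoint[of s "indicator (A \<inter> X i)" "indicator (B \<inter> X i)"] s L2
        L2_inner_commute[of M "indicator (A \<inter> X i)" "P s (indicator (B \<inter> X i))"]
      by simp
    then show ?thesis
      using emeasure_joint_finite_rectangle[OF s mem(1) fin mem(2) fin]
        emeasure_joint_finite_rectangle[OF s mem(2) fin mem(1) fin] by simp
  qed
  then show ?thesis
    by (simp only: sup[OF assms(2,3)] sup[OF assms(3,2)])
qed

text \<open>The kernels have total mass 1. Besides giving the second marginal, this yields the
  exhaustion by sets of finite measure in the uniqueness argument below.\<close>

lemma emeasure_joint_univ_snd:
  assumes s: "0 < s" and [measurable]: "B \<in> sets M"
  shows "emeasure (joint s) (space M \<times> B) = emeasure M B"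
proof -
  have "emeasure (joint s) (space M \<times> B) = (\<integral>\<^sup>+y. emeasure (k s y) (space M) * indicator B y \<partial>M)"
    using s by (intro emeasure_joint_rectangle) auto
  also have "\<dots> = (\<integral>\<^sup>+y. indicator B y \<partial>M)"
  proof (rule nn_integral_cong)
    fix y
    assume y: "y \<in> space M"
    interpret prob_space "k s y"
      using prob_space_kernel[OF s y] .
    show "emeasure (k s y) (space M) * indicator B y = indicator B y"
      using emeasure_space_1 sets_eq_imp_space_eq[OF sets_kernel[OF s y]] by simp
  qed
  finally show ?thesis
    by simp
qed

text \<open>Rectangles form an intersection-stable generator on which both measures agree, and
  \<open>space M \<times> X i\<close> exhausts the product by sets of finite measure.\<close>

lemma distr_joint_swap:
  assumes s: "0 < s"
  shows "distr (joint s) (M \<Otimes>\<^sub>M M) (\<lambda>z. (snd z, fst z)) = joint s"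
proof -
  obtain X :: "nat \<Rightarrow> 'a set" where X: "range X \<subseteq> sets M" "(\<Union>i. X i) = space M"
      "\<And>i. emeasure M (X i) \<noteq> \<infinity>"
    using sigma_finite by blast
  have [measurable]: "X i \<in> sets M" for i
    using X by auto
  let ?E = "{A \<times> B | A B. A \<in> sets M \<and> B \<in> sets M}"
  show ?thesis
  proof (rule measure_eqI_generator_eq[OF Int_stable_pair_measure_generator, symmetric])
    show "?E \<subseteq> Pow (space M \<times> space M)"
      using sets.sets_into_space[of _ M] by auto
    show "sets (joint s) = sigma_sets (space M \<times> space M) ?E"
      using s by (simp add: sets_pair_measure)
    show "sets (distr (joint s) (M \<Otimes>\<^sub>M M) (\<lambda>z. (snd z, fst z))) = sigma_sets (space M \<times> space M) ?E"
      by (simp add: sets_pair_measure)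
    show "range (\<lambda>i. space M \<times> X i) \<subseteq> ?E"
      by (intro image_subsetI CollectI exI conjI refl) auto
    show "(\<Union>i. space M \<times> X i) = space M \<times> space M"
      using X(2) by auto
    show "emeasure (joint s) (space M \<times> X i) \<noteq> \<infinity>" for i
      using X(3) s by (simp add: emeasure_joint_univ_snd)
    fix Z
    assume "Z \<in> ?E"
    then obtain A B where Z: "Z = A \<times> B" and [measurable]: "A \<in> sets M" "B \<in> sets M"
      by auto
    have "(\<lambda>z. (snd z, fst z)) -` (A \<times> B) \<inter> space (joint s) = B \<times> A"
      using sets.sets_into_space[of A M] sets.sets_into_space[of B M]
        sets_eq_imp_space_eq[OF sets_joint[OF s]] by (auto simp: space_pair_measure)
    then have "emeasure (distr (joint s) (M \<Otimes>\<^sub>M M) (\<lambda>z. (snd z, fst z))) (A \<times> B) = emeasure (joint s) (B \<times> A)"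
      using s by (subst emeasure_distr) (auto cong: measurable_cong_sets)
    then show "emeasure (joint s) Z = emeasure (distr (joint s) (M \<Otimes>\<^sub>M M) (\<lambda>z. (snd z, fst z))) Z"
      using s Z by (simp add: emeasure_joint_swap[of s A B])
  qed
qed

section \<open>Marginals of the joint measure\<close>

lemma measurable_joint [simp]: "0 < s \<Longrightarrow> measurable (joint s) N = measurable (M \<Otimes>\<^sub>M M) N"
  by (intro measurable_cong_sets) auto

lemma distr_joint_snd:
  assumes s: "0 < s"
  shows "distr (joint s) M snd = M"
proof (rule measure_eqI)
  fix A
  assume "A \<in> sets (distr (joint s) M snd)"
  then have [measurable]: "A \<in> sets M"
    by simp
  have "snd -` A \<inter> space (joint s) = space M \<times> A"
    using sets.sets_into_space[of A M] sets_eq_imp_space_eq[OF sets_joint[OF s]]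
    by (auto simp: space_pair_measure)
  then show "emeasure (distr (joint s) M snd) A = emeasure M A"
    using s by (subst emeasure_distr) (auto simp: emeasure_joint_univ_snd)
qed simp

text \<open>Symmetry turns the second marginal into the first, so \<mu> is invariant under the
  kernel.\<close>

lemma distr_joint_fst:
  assumes s: "0 < s"
  shows "distr (joint s) M fst = M"
proof -
  have "distr (joint s) M fst = distr (distr (joint s) (M \<Otimes>\<^sub>M M) (\<lambda>z. (snd z, fst z))) M fst"
    using s by (simp add: distr_joint_swap)
  also have "\<dots> = distr (joint s) M snd"
    using s by (subst distr_distr) (auto simp: comp_def)
  finally show ?thesis
    using s by (simp add: distr_joint_snd)
qed

lemma integrable_joint_fst:
  fixes g :: "'a \<Rightarrow> real"
  assumes s: "0 < s" and "integrable M g"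
  shows "integrable (joint s) (\<lambda>z. g (fst z))" "(LINT z|joint s. g (fst z)) = (LINT x|M. g x)"
proof -
  have [measurable]: "g \<in> borel_measurable M"
    using assms by auto
  show "integrable (joint s) (\<lambda>z. g (fst z))"
    using s assms integrable_distr_eq[of fst "joint s" M g] by (simp add: distr_joint_fst)
  show "(LINT z|joint s. g (fst z)) = (LINT x|M. g x)"
    using s integral_distr[of fst "joint s" M g] by (simp add: distr_joint_fst)
qed

lemma integrable_joint_snd:
  fixes g :: "'a \<Rightarrow> real"
  assumes s: "0 < s" and "integrable M g"
  shows "integrable (joint s) (\<lambda>z. g (snd z))" "(LINT z|joint s. g (snd z)) = (LINT x|M. g x)"
proof -
  have [measurable]: "g \<in> borel_measurable M"
    using assms by auto
  show "integrable (joint s) (\<lambda>z. g (snd z))"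
    using s assms integrable_distr_eq[of snd "joint s" M g] by (simp add: distr_joint_snd)
  show "(LINT z|joint s. g (snd z)) = (LINT x|M. g x)"
    using s integral_distr[of snd "joint s" M g] by (simp add: distr_joint_snd)
qed

lemma integral_joint_swap:
  fixes F :: "'a \<times> 'a \<Rightarrow> real"
  assumes s: "0 < s" and [measurable]: "F \<in> borel_measurable (M \<Otimes>\<^sub>M M)"
  shows "(LINT z|joint s. F (snd z, fst z)) = (LINT z|joint s. F z)"
  using s integral_distr[of "\<lambda>z. (snd z, fst z)" "joint s" "M \<Otimes>\<^sub>M M" F]
  by (simp add: distr_joint_swap)

section \<open>Iterated integrals and the kernel representation on L^q\<close>

lemma AE_kernel_integral_finite:
  assumes s: "0 < s" and F [measurable]: "F \<in> borel_measurable (M \<Otimes>\<^sub>M M)"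
    and fin: "(\<integral>\<^sup>+z. F z \<partial>joint s) < \<infinity>"
  shows "AE y in M. (\<integral>\<^sup>+x. F (x, y) \<partial>k s y) < \<infinity>"
proof -
  have "(\<lambda>y. \<integral>\<^sup>+x. F (x, y) \<partial>k s y) \<in> borel_measurable M"
    by (rule nn_integral_measurable_subprob_algebra2[where N = M])
      (use measurable_prob_algebraD[OF kernel_measurable[OF s]] in \<open>auto simp: split_beta'\<close>)
  moreover have "(\<integral>\<^sup>+y. (\<integral>\<^sup>+x. F (x, y) \<partial>k s y) \<partial>M) \<noteq> \<infinity>"
    using fin s F by (simp add: nn_integral_joint)
  ultimately show ?thesis
    using nn_integral_PInf_AE by (auto simp: less_top)
qed

text \<open>Reduces to \<open>nn_integral_joint\<close> on the positive and negative parts, whose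
  inner integrals are finite for a.e. y.\<close>

lemma integral_joint:
  fixes F :: "'a \<times> 'a \<Rightarrow> real"
  assumes s: "0 < s" and F: "integrable (joint s) F"
  shows "(LINT z|joint s. F z) = (LINT y|M. (LINT x|k s y. F (x, y)))"
    and "AE y in M. integrable (k s y) (\<lambda>x. F (x, y))"
proof -
  have [measurable]: "F \<in> borel_measurable (M \<Otimes>\<^sub>M M)"
    using borel_measurable_integrable[OF F] s by simp
  have ksub: "k s \<in> M \<rightarrow>\<^sub>M subprob_algebra M"
    using measurable_prob_algebraD[OF kernel_measurable[OF s]] .
  have sect: "(\<lambda>x. F (x, y)) \<in> borel_measurable (k s y)" if "y \<in> space M" for y
    using that by (simp cong: measurable_cong_sets add: sets_kernel[OF s that])
  \<comment> \<open>\<open>ennreal\<close> sends negative numbers to 0, so c = 1 and c = -1 give the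
    integrals of the positive and the negative part.\<close>
  define A where "A c y = (\<integral>\<^sup>+x. ennreal (c * F (x, y)) \<partial>k s y)" for c y
  have A_meas [measurable]: "A c \<in> borel_measurable M" for c
    unfolding A_def by (rule nn_integral_measurable_subprob_algebra2[where N = M]) (use ksub in \<open>auto simp: split_beta'\<close>)
  have A_int: "(\<integral>\<^sup>+y. A c y \<partial>M) = (\<integral>\<^sup>+z. ennreal (c * F z) \<partial>joint s)" for c
    unfolding A_def using s by (intro nn_integral_joint[symmetric]) auto
  have fin: "(\<integral>\<^sup>+z. ennreal (c * F z) \<partial>joint s) < \<infinity>" for c
  proof -
    have "integrable (joint s) (\<lambda>z. c * F z)"
      using F by simp
    then have "(\<integral>\<^sup>+z. ennreal (norm (c * F z)) \<partial>joint s) < \<infinity>"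
      unfolding integrable_iff_bounded by simp
    moreover have "(\<integral>\<^sup>+z. ennreal (c * F z) \<partial>joint s) \<le> (\<integral>\<^sup>+z. ennreal (norm (c * F z)) \<partial>joint s)"
      by (intro nn_integral_mono ennreal_leI) simp
    ultimately show ?thesis
      by (rule le_less_trans[rotated])
  qed
  have A_fin: "AE y in M. A c y < \<infinity>" for c
    unfolding A_def using AE_kernel_integral_finite[OF s _ fin, of c] by simp
  have A_real: "integrable M (\<lambda>y. enn2real (A c y))"
      "(LINT y|M. enn2real (A c y)) = enn2real (\<integral>\<^sup>+z. ennreal (c * F z) \<partial>joint s)" for c
  proof -
    have *: "(\<integral>\<^sup>+y. ennreal (enn2real (A c y)) \<partial>M) = (\<integral>\<^sup>+z. ennreal (c * F z) \<partial>joint s)"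
      unfolding A_int[symmetric]
      by (rule nn_integral_cong_AE) (use A_fin[of c] in eventually_elim, simp add: less_top)
    then show "integrable M (\<lambda>y. enn2real (A c y))"
      using fin[of c] by (intro integrableI_nonneg) auto
    show "(LINT y|M. enn2real (A c y)) = enn2real (\<integral>\<^sup>+z. ennreal (c * F z) \<partial>joint s)"
      using * by (subst integral_eq_nn_integral) auto
  qed
  show int: "AE y in M. integrable (k s y) (\<lambda>x. F (x, y))"
    using A_fin[of 1] A_fin[of "-1"] AE_space
  proof eventually_elim
    case (elim y)
    then show ?case
      using sect[of y] unfolding A_def real_integrable_def by (simp add: less_top)
  qed
  have "(LINT y|M. (LINT x|k s y. F (x, y))) = (LINT y|M. enn2real (A 1 y) - enn2real (A (-1) y))"
  proof (rule integral_cong_AE)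
    show "(\<lambda>y. LINT x|k s y. F (x, y)) \<in> borel_measurable M"
    proof (subst measurable_cong)
      show "(\<lambda>y. LINT z|distr (k s y) (M \<Otimes>\<^sub>M M) (\<lambda>x. (x, y)). F z) \<in> borel_measurable M"
        by (rule measurable_compose[OF joint_kernel_measurable[OF s] integral_measurable_subprob_algebra]) simp
      fix y
      assume y: "y \<in> space M"
      have "(\<lambda>x. (x, y)) \<in> k s y \<rightarrow>\<^sub>M M \<Otimes>\<^sub>M M"
        using y by (simp cong: measurable_cong_sets add: sets_kernel[OF s y])
      then show "(LINT x|k s y. F (x, y)) = (LINT z|distr (k s y) (M \<Otimes>\<^sub>M M) (\<lambda>x. (x, y)). F z)"
        by (intro integral_distr[symmetric]) auto
    qed
    show "AE y in M. (LINT x|k s y. F (x, y)) = enn2real (A 1 y) - enn2real (A (-1) y)"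
      using int by eventually_elim (simp add: real_lebesgue_integral_def A_def)
  qed simp
  also have "\<dots> = (LINT z|joint s. F z)"
    using F by (simp add: A_real real_lebesgue_integral_def[OF F])
  finally show "(LINT z|joint s. F z) = (LINT y|M. (LINT x|k s y. F (x, y)))" ..
qed

text \<open>Apply the bounded representation to truncations of v. On the kernel side they converge
  by dominated convergence, since invariance of \<mu> makes |v|^q integrable for a.e. kernel
  measure; on the semigroup side they converge in L^q by contraction.
  \<open>Lp_tendsto_AE_unique\<close> identifies the limits.\<close>

lemma kernel_rep_Lp:
  assumes s: "0 < s" and q: "1 \<le> q" and v: "v \<in> Lp_space M q"
  shows "AE y in M. P s v y = (LINT x|k s y. v x)"
proof -
  define w where "w n x = max (- real n) (min (real n) (v x))" for n x
  note w = Lp_truncation[OF v q, folded w_def]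
  have [measurable]: "v \<in> borel_measurable M" "w n \<in> borel_measurable M" for n
    using v w(1) by auto
  have mem: "P s v \<in> Lp_space M q" "P s (w n) \<in> Lp_space M q" for n
    using s q v w(1) by (auto intro!: P_Lp)
  have "integrable (joint s) (\<lambda>z. \<bar>v (fst z)\<bar> powr q)"
    using v s by (intro integrable_joint_fst(1)) (auto simp: Lp_space_def)
  from integral_joint(2)[OF s this]
  have intq: "AE y in M. integrable (k s y) (\<lambda>x. \<bar>v x\<bar> powr q)"
    by simp
  have "AE y in M. \<forall>n. P s (w n) y = (LINT x|k s y. w n x)"
    unfolding AE_all_countable
    using s w(3) by (auto intro!: kernel_rep_bounded)
  then have "AE y in M. (\<lambda>n. P s (w n) y) \<longlonglongrightarrow> (LINT x|k s y. v x)"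
    using intq AE_space
  proof eventually_elim
    case (elim y)
    interpret prob_space "k s y"
      using prob_space_kernel[OF s] elim by simp
    have meas: "g \<in> borel_measurable (k s y)" if "g \<in> borel_measurable M" for g :: "'a \<Rightarrow> real"
      using that elim by (simp cong: measurable_cong_sets add: sets_kernel[OF s])
    have "(\<lambda>n. LINT x|k s y. w n x) \<longlonglongrightarrow> (LINT x|k s y. v x)"
    proof (rule integral_dominated_convergence)
      \<comment> \<open>For q >= 1 this function dominates |v|, and the constant is integrable
        because the kernel is a probability measure.\<close>
      show "integrable (k s y) (\<lambda>x. 1 + \<bar>v x\<bar> powr q)"
        using elim by simp
      show "AE x in k s y. norm (w n x) \<le> 1 + \<bar>v x\<bar> powr q" for n
      proof (rule AE_I2)
        fix x
        have "\<bar>v x\<bar> \<le> 1 + \<bar>v x\<bar> powr q"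
        proof (cases "1 \<le> \<bar>v x\<bar>")
          case True
          then show ?thesis
            using powr_mono[OF q, of "\<bar>v x\<bar>"] by simp
        qed (simp add: add_increasing2)
        then show "norm (w n x) \<le> 1 + \<bar>v x\<bar> powr q"
          using w(4)[of n x] by simp
      qed
      show "AE x in k s y. (\<lambda>n. w n x) \<longlonglongrightarrow> v x"
        using w(5) by simp
    qed (auto intro: meas)
    then show ?case
      using elim by simp
  qed
  moreover have diff: "(\<lambda>x. P s (w n) x - P s v x) \<in> Lp_space M q" for n
    using mem q by (intro Lp_diff) auto
  moreover have "(\<lambda>n. Lp_norm M q (\<lambda>x. P s (w n) x - P s v x)) \<longlonglongrightarrow> 0"
  proof (rule tendsto_sandwich[OF _ _ tendsto_const w(2)])
    show "\<forall>\<^sub>F n in sequentially. Lp_norm M q (\<lambda>x. P s (w n) x - P s v x) \<le> Lp_norm M q (\<lambda>x. w n x - v x)"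
    proof (rule always_eventually, rule allI)
      fix n
      have d: "(\<lambda>x. w n x - v x) \<in> Lp_space M q"
        using w(1) v q by (intro Lp_diff) auto
      have "Lp_norm M q (\<lambda>x. P s (w n) x - P s v x) = Lp_norm M q (P s (\<lambda>x. w n x - v x))"
        using P_diff[OF q _ w(1) v, of s n] s q d diff P_Lp(1)[OF q _ d, of s]
        by (intro Lp_norm_cong_AE) (auto elim: eventually_mono)
      also have "\<dots> \<le> Lp_norm M q (\<lambda>x. w n x - v x)"
        using s q d by (intro P_Lp) auto
      finally show "Lp_norm M q (\<lambda>x. P s (w n) x - P s v x) \<le> Lp_norm M q (\<lambda>x. w n x - v x)" .
    qed
  qed simp
  ultimately show ?thesis
    using q by (intro Lp_tendsto_AE_unique[OF mem(2) mem(1)]) auto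
qed

end

section \<open>The Besov estimate\<close>

text \<open>Replace both numbers by their maximum. This crude form of Young's inequality gives the
  integrability of every product with a signed power.\<close>

lemma mult_powr_le_sum:
  fixes x y p :: real
  assumes "0 \<le> x" "0 \<le> y" "1 \<le> p"
  shows "x * y powr (p - 1) \<le> x powr p + y powr p"
proof -
  define m where "m = max x y"
  have "0 \<le> m"
    using assms by (simp add: m_def)
  have "x * y powr (p - 1) \<le> m * m powr (p - 1)"
    using assms \<open>0 \<le> m\<close> by (intro mult_mono powr_mono2) (auto simp: m_def)
  also have "\<dots> = m powr p"
    using \<open>0 \<le> m\<close> by (cases "m = 0") (auto simp: powr_diff)
  also have "\<dots> \<le> x powr p + y powr p"
    by (auto simp: m_def max_def)
  finally show ?thesis .
qed

lemma abs_mult_signed_powr_le: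
  assumes "1 \<le> p"
  shows "\<bar>x * signed_powr y (p - 1)\<bar> \<le> \<bar>x\<bar> powr p + \<bar>y\<bar> powr p"
  using mult_powr_le_sum[of "\<bar>x\<bar>" "\<bar>y\<bar>" p] assms by (simp add: abs_mult abs_signed_powr)

lemma measurable_signed_powr [measurable]:
  assumes [measurable]: "f \<in> borel_measurable M"
  shows "(\<lambda>x. signed_powr (f x) r) \<in> borel_measurable M"
  unfolding signed_powr_def by measurable

section \<open>Energy identity and integrated differences\<close>

context heat_kernel_semigroup
begin

text \<open>Expand the product. The diagonal terms are |u|^p under the two marginals; by symmetry
  the cross terms coincide, and by the kernel representation each is the integral of P_s u times the
  signed power of u.\<close>

lemma joint_energy:
  assumes s: "0 < s" and p: "1 < p" and u: "u \<in> Lp_space M p"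
  defines "G \<equiv> \<lambda>z. (u (fst z) - u (snd z))
    * (signed_powr (u (fst z)) (p - 1) - signed_powr (u (snd z)) (p - 1))"
  shows "integrable (joint s) G"
    and "(LINT z|joint s. G z) = 2 * (LINT y|M. D s u y * signed_powr (u y) (p - 1))"
proof -
  let ?w = "\<lambda>x. signed_powr (u x) (p - 1)"
  have q: "1 \<le> p"
    using p by simp
  have [measurable]: "u \<in> borel_measurable M" "P s u \<in> borel_measurable M"
    using u P_Lp(1)[OF q _ u, of s] s by auto
  have intu: "integrable M (\<lambda>x. \<bar>u x\<bar> powr p)" and intPu: "integrable M (\<lambda>x. \<bar>P s u x\<bar> powr p)"
    using u P_Lp(1)[OF q _ u, of s] s by (auto simp: Lp_space_def)
  note i1 = integrable_joint_fst[OF s intu] and i2 = integrable_joint_snd[OF s intu]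
  have cross: "integrable (joint s) (\<lambda>z. u (fst z) * ?w (snd z))"
    using Bochner_Integration.integrable_add[OF i1(1) i2(1)]
    by (rule Bochner_Integration.integrable_bound)
      (use s abs_mult_signed_powr_le[OF q] in \<open>auto intro!: AE_I2\<close>)
  have cross': "integrable (joint s) (\<lambda>z. u (snd z) * ?w (fst z))"
    using Bochner_Integration.integrable_add[OF i2(1) i1(1)]
    by (rule Bochner_Integration.integrable_bound)
      (use s abs_mult_signed_powr_le[OF q] in \<open>auto intro!: AE_I2\<close>)
  have G: "G z = (\<bar>u (fst z)\<bar> powr p + \<bar>u (snd z)\<bar> powr p)
      - (u (fst z) * ?w (snd z) + u (snd z) * ?w (fst z))" for z
    unfolding G_def mult_signed_powr[symmetric] by (simp add: algebra_simps)
  show "integrable (joint s) G"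
    unfolding G using i1 i2 cross cross' by simp
  have swap: "(LINT z|joint s. u (snd z) * ?w (fst z)) = (LINT z|joint s. u (fst z) * ?w (snd z))"
    using s integral_joint_swap[of s "\<lambda>z. u (fst z) * ?w (snd z)"] by simp
  have "(LINT z|joint s. u (fst z) * ?w (snd z)) = (LINT y|M. (LINT x|k s y. u x * ?w y))"
    using integral_joint(1)[OF s cross] by simp
  also have "\<dots> = (LINT y|M. P s u y * ?w y)"
  proof -
    have *: "AE y in M. (LINT x|k s y. u x * ?w y) = P s u y * ?w y"
      using kernel_rep_Lp[OF s q u] by eventually_elim simp
    have "(\<lambda>y. LINT x|k s y. u x * ?w y) \<in> borel_measurable M"
    proof -
      have "(\<lambda>y. LINT x|k s y. u x) \<in> borel_measurable M"
        by (rule measurable_compose[OF measurable_prob_algebraD[OF kernel_measurable[OF s]]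
              integral_measurable_subprob_algebra]) simp
      then show ?thesis
        by simp
    qed
    then show ?thesis
      using * by (intro integral_cong_AE) auto
  qed
  finally have c: "(LINT z|joint s. u (fst z) * ?w (snd z)) = (LINT y|M. P s u y * ?w y)" .
  have intPw: "integrable M (\<lambda>y. P s u y * ?w y)"
    using Bochner_Integration.integrable_add[OF intPu intu]
    by (rule Bochner_Integration.integrable_bound)
      (use abs_mult_signed_powr_le[OF q] in \<open>auto intro!: AE_I2\<close>)
  have "(LINT z|joint s. G z) = 2 * (LINT x|M. \<bar>u x\<bar> powr p) - 2 * (LINT y|M. P s u y * ?w y)"
    unfolding G using i1 i2 cross cross' swap c by simp
  also have "\<dots> = 2 * (LINT y|M. \<bar>u y\<bar> powr p - P s u y * ?w y)"
    using intu intPw by simp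
  also have "\<dots> = 2 * (LINT y|M. D s u y * ?w y)"
    unfolding heat_diff_def mult_signed_powr[symmetric] left_diff_distrib ..
  finally show "(LINT z|joint s. G z) = 2 * (LINT y|M. D s u y * ?w y)" .
qed

text \<open>Integrates \<open>diff_powr_le\<close>: the energy is of size e times N^p, which turns
  \<open>e powr (p / 2 - 1)\<close> into \<open>e powr (p / 2)\<close>. In the application e = s /
  t, and N is the norm of the initial function f, not of u = P_t f.\<close>

lemma joint_diff_powr_le_small:
  assumes s: "0 < s" and p: "1 < p" "p \<le> 2" and u: "u \<in> Lp_space M p"
    and e: "0 < e" "e \<le> 1" and N: "0 \<le> N" "Lp_norm M p u \<le> N" "Lp_norm M p (D s u) \<le> C * e * N" "0 \<le> C"
  shows "(\<integral>\<^sup>+z. ennreal (\<bar>u (fst z) - u (snd z)\<bar> powr p) \<partial>joint s)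
    \<le> ennreal ((4 / (p - 1) * (C powr p + 1) + 2) * e powr (p / 2) * N powr p)"
proof -
  let ?w = "\<lambda>x. signed_powr (u x) (p - 1)"
  let ?G = "\<lambda>z. (u (fst z) - u (snd z)) * (?w (fst z) - ?w (snd z))"
  let ?a = "2 / (p - 1) * e powr (p / 2 - 1)"
  let ?R = "\<lambda>z. ?a * ?G z + e powr (p / 2) * (\<bar>u (fst z)\<bar> powr p + \<bar>u (snd z)\<bar> powr p)"
  have q: "1 \<le> p"
    using p by simp
  have Du: "D s u \<in> Lp_space M p"
    using q s u by (intro D_Lp) auto
  have [measurable]: "u \<in> borel_measurable M" "D s u \<in> borel_measurable M"
    using u Du by auto
  have intu: "integrable M (\<lambda>x. \<bar>u x\<bar> powr p)" and intD: "integrable M (\<lambda>x. \<bar>D s u x\<bar> powr p)"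
    using u Du by (auto simp: Lp_space_def)
  note i1 = integrable_joint_fst[OF s intu] and i2 = integrable_joint_snd[OF s intu]
  note en = joint_energy[OF s p(1) u]
  have uN: "(LINT x|M. \<bar>u x\<bar> powr p) \<le> N powr p"
    using N p Lp_norm_le_iff[of p N M u] by simp
  have DN: "(LINT x|M. \<bar>D s u x\<bar> powr p) \<le> (C * e * N) powr p"
    using N e p Lp_norm_le_iff[of p "C * e * N" M "D s u"] by simp
  \<comment> \<open>Dividing \<open>D s u\<close> by e first makes both terms of Young's inequality
    comparable to N^p and leaves one factor e in front.\<close>
  have "(LINT y|M. D s u y * ?w y) \<le> (LINT y|M. e * (e powr (- p) * \<bar>D s u y\<bar> powr p + \<bar>u y\<bar> powr p))"
  proof (rule integral_mono)
    show "integrable M (\<lambda>y. D s u y * ?w y)"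
      using Bochner_Integration.integrable_add[OF intD intu]
      by (rule Bochner_Integration.integrable_bound)
        (use abs_mult_signed_powr_le[OF q] in \<open>auto intro!: AE_I2\<close>)
    show "integrable M (\<lambda>y. e * (e powr (- p) * \<bar>D s u y\<bar> powr p + \<bar>u y\<bar> powr p))"
      using intD intu by simp
    fix y
    have "D s u y * ?w y = e * (D s u y / e * ?w y)"
      using e by simp
    also have "\<dots> \<le> e * (\<bar>D s u y / e\<bar> powr p + \<bar>u y\<bar> powr p)"
      using e by (intro mult_left_mono order_trans[OF abs_ge_self abs_mult_signed_powr_le[OF q]]) auto
    also have "\<bar>D s u y / e\<bar> powr p = e powr (- p) * \<bar>D s u y\<bar> powr p"
      using e by (simp add: abs_divide powr_divide powr_minus_divide)
    finally show "D s u y * ?w y \<le> e * (e powr (- p) * \<bar>D s u y\<bar> powr p + \<bar>u y\<bar> powr p)" .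
  qed
  also have "\<dots> = e * (e powr (- p) * (LINT y|M. \<bar>D s u y\<bar> powr p) + (LINT y|M. \<bar>u y\<bar> powr p))"
    using intD intu by simp
  also have "\<dots> \<le> e * (e powr (- p) * (C * e * N) powr p + N powr p)"
    using uN DN e by (intro mult_left_mono add_mono) auto
  also have "e powr (- p) * (C * e * N) powr p = C powr p * N powr p"
    using e by (simp add: powr_mult powr_minus field_simps)
  finally have w: "(LINT y|M. D s u y * ?w y) \<le> e * (C powr p + 1) * N powr p"
    by (simp add: algebra_simps)
  have R_int: "integrable (joint s) ?R"
    using en(1) i1(1) i2(1) by simp
  have R_ge: "\<bar>u (fst z) - u (snd z)\<bar> powr p \<le> ?R z" for z
    by (rule diff_powr_le[OF p e])
  have "(\<integral>\<^sup>+z. ennreal (\<bar>u (fst z) - u (snd z)\<bar> powr p) \<partial>joint s) \<le> (\<integral>\<^sup>+z. ennreal (?R z) \<partial>joint s)"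
    by (intro nn_integral_mono ennreal_leI R_ge)
  also have "\<dots> = ennreal (LINT z|joint s. ?R z)"
    by (rule nn_integral_eq_integral[OF R_int]) (intro AE_I2 order_trans[OF _ R_ge], simp)
  also have "\<dots> \<le> ennreal ((4 / (p - 1) * (C powr p + 1) + 2) * e powr (p / 2) * N powr p)"
  proof (rule ennreal_leI)
    have "(LINT z|joint s. ?R z) = ?a * (2 * (LINT y|M. D s u y * ?w y))
        + e powr (p / 2) * (2 * (LINT x|M. \<bar>u x\<bar> powr p))"
      using en i1 i2 by simp
    also have "\<dots> \<le> ?a * (2 * (e * (C powr p + 1) * N powr p)) + e powr (p / 2) * (2 * N powr p)"
      using w uN p by (intro add_mono mult_left_mono) auto
    also have "?a * (2 * (e * (C powr p + 1) * N powr p))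
        = 4 / (p - 1) * (C powr p + 1) * N powr p * (e powr (p / 2 - 1) * e)"
      by (simp add: mult_ac)
    also have "e powr (p / 2 - 1) * e = e powr (p / 2)"
      using e by (simp add: powr_diff)
    finally show "(LINT z|joint s. ?R z) \<le> (4 / (p - 1) * (C powr p + 1) + 2) * e powr (p / 2) * N powr p"
      by (simp add: algebra_simps)
  qed
  finally show ?thesis .
qed

text \<open>Uses only |x - y|^p <= 2 (|x|^p + |y|^p), which holds since 2^(p-1) <= 2, together with
  the two marginals.\<close>

lemma joint_diff_powr_le_large:
  assumes s: "0 < s" and p: "1 < p" "p \<le> 2" and u: "u \<in> Lp_space M p" and N: "0 \<le> N" "Lp_norm M p u \<le> N"
  shows "(\<integral>\<^sup>+z. ennreal (\<bar>u (fst z) - u (snd z)\<bar> powr p) \<partial>joint s) \<le> ennreal (4 * N powr p)"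
proof -
  let ?R = "\<lambda>z. 2 * (\<bar>u (fst z)\<bar> powr p + \<bar>u (snd z)\<bar> powr p)"
  have intu: "integrable M (\<lambda>x. \<bar>u x\<bar> powr p)"
    using u by (auto simp: Lp_space_def)
  note i1 = integrable_joint_fst[OF s intu] and i2 = integrable_joint_snd[OF s intu]
  have uN: "(LINT x|M. \<bar>u x\<bar> powr p) \<le> N powr p"
    using N p Lp_norm_le_iff[of p N M u] by simp
  have R_ge: "\<bar>u (fst z) - u (snd z)\<bar> powr p \<le> ?R z" for z
  proof -
    have "(1/2) powr (1 - p) \<le> (1/2::real) powr (-1)"
      using p by (intro powr_mono') auto
    then have 2: "(1/2) powr (1 - p) \<le> (2::real)"
      by (simp add: powr_minus)
    have "\<bar>u (fst z) + - u (snd z)\<bar> powr p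
        \<le> (1/2) powr (1 - p) * \<bar>u (fst z)\<bar> powr p + (1 - 1/2) powr (1 - p) * \<bar>- u (snd z)\<bar> powr p"
      using p by (intro abs_add_powr_le) auto
    also have "\<dots> \<le> 2 * \<bar>u (fst z)\<bar> powr p + 2 * \<bar>u (snd z)\<bar> powr p"
      using 2 by (intro add_mono mult_mono) auto
    finally show ?thesis
      by simp
  qed
  have "(\<integral>\<^sup>+z. ennreal (\<bar>u (fst z) - u (snd z)\<bar> powr p) \<partial>joint s) \<le> (\<integral>\<^sup>+z. ennreal (?R z) \<partial>joint s)"
    by (intro nn_integral_mono ennreal_leI R_ge)
  also have "\<dots> = ennreal (LINT z|joint s. ?R z)"
    using i1(1) i2(1) by (intro nn_integral_eq_integral) auto
  also have "(LINT z|joint s. ?R z) = 4 * (LINT x|M. \<bar>u x\<bar> powr p)"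
    using i1 i2 by simp
  also have "ennreal (4 * (LINT x|M. \<bar>u x\<bar> powr p)) \<le> ennreal (4 * N powr p)"
    using uN by (intro ennreal_leI) simp
  finally show ?thesis .
qed

text \<open>Joins the two regimes: analyticity for s <= t; for s > t the power of s / t is at least
  1, so the trivial bound with constant 4 is enough.\<close>

lemma heat_Besov_integral_bound:
  assumes p: "1 < p" "p \<le> 2"
  shows "\<exists>C>0. \<forall>f\<in>Lp_space M p. \<forall>s>0. \<forall>t>0.
    (\<integral>\<^sup>+y. (\<integral>\<^sup>+x. ennreal (\<bar>P t f x - P t f y\<bar> powr p) \<partial>k s y) \<partial>M)
      \<le> ennreal (C * (s / t) powr (p / 2) * Lp_norm M p f powr p)"
proof -
  obtain B where B: "0 \<le> B" and sm: "\<And>f s t. f \<in> Lp_space M p \<Longrightarrow> 0 < s \<Longrightarrow> s \<le> t \<Longrightarrow>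
     Lp_norm M p (D s (P t f)) \<le> B * (s / t) * Lp_norm M p f"
    using smoothing_Lp[OF p] unfolding smoothing_def by blast
  define C where "C = max 4 (4 / (p - 1) * (B powr p + 1) + 2)"
  have "(\<integral>\<^sup>+y. (\<integral>\<^sup>+x. ennreal (\<bar>P t f x - P t f y\<bar> powr p) \<partial>k s y) \<partial>M)
      \<le> ennreal (C * (s / t) powr (p / 2) * Lp_norm M p f powr p)"
    if f: "f \<in> Lp_space M p" and s: "0 < s" and t: "0 < t" for f s t
  proof -
    have u: "P t f \<in> Lp_space M p" "Lp_norm M p (P t f) \<le> Lp_norm M p f"
      using P_Lp[of p t f] p t f by auto
    have [measurable]: "P t f \<in> borel_measurable M"
      using u by auto
    have "(\<integral>\<^sup>+y. (\<integral>\<^sup>+x. ennreal (\<bar>P t f x - P t f y\<bar> powr p) \<partial>k s y) \<partial>M)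
        = (\<integral>\<^sup>+z. ennreal (\<bar>P t f (fst z) - P t f (snd z)\<bar> powr p) \<partial>joint s)"
      using s by (subst nn_integral_joint) auto
    also have "\<dots> \<le> ennreal (C * (s / t) powr (p / 2) * Lp_norm M p f powr p)"
    proof (cases "s \<le> t")
      case True
      have "(\<integral>\<^sup>+z. ennreal (\<bar>P t f (fst z) - P t f (snd z)\<bar> powr p) \<partial>joint s)
          \<le> ennreal ((4 / (p - 1) * (B powr p + 1) + 2) * (s / t) powr (p / 2) * Lp_norm M p f powr p)"
        using s t True u sm[OF f s True] B by (intro joint_diff_powr_le_small p) auto
      also have "\<dots> \<le> ennreal (C * (s / t) powr (p / 2) * Lp_norm M p f powr p)"
        by (intro ennreal_leI mult_right_mono) (auto simp: C_def)
      finally show ?thesis .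
    next
      case False
      have "(\<integral>\<^sup>+z. ennreal (\<bar>P t f (fst z) - P t f (snd z)\<bar> powr p) \<partial>joint s)
          \<le> ennreal (4 * Lp_norm M p f powr p)"
        using s u by (intro joint_diff_powr_le_large p) auto
      also have "\<dots> \<le> ennreal (C * (s / t) powr (p / 2) * Lp_norm M p f powr p)"
      proof (intro ennreal_leI mult_right_mono)
        have "1 \<le> (s / t) powr (p / 2)"
          using False t p by (intro ge_one_powr_ge_zero) auto
        then have "4 * 1 \<le> C * (s / t) powr (p / 2)"
          by (intro mult_mono) (auto simp: C_def)
        then show "4 \<le> C * (s / t) powr (p / 2)"
          by simp
      qed simp
      finally show ?thesis .
    qed
    finally show ?thesis .
  qed
  then show ?thesis
    by (intro exI[of _ C]) (auto simp: C_def)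
qed

end

section \<open>From the integral bound to the Besov norm\<close>

lemma enn_powr_le:
  assumes "x \<le> ennreal c" "0 \<le> c" "0 < r"
  shows "enn_powr x r \<le> ennreal (c powr r)"
proof -
  have "x \<noteq> \<infinity>"
    using assms(1) by (auto simp: top_unique)
  moreover have "enn2real x \<le> c"
    using assms enn2real_mono[OF assms(1)] by simp
  ultimately show ?thesis
    using assms by (auto simp: enn_powr_def intro!: ennreal_leI powr_mono2)
qed

theorem theorem5p1:
  fixes M :: "'a measure"
    and \<E> :: "('a \<Rightarrow> real) \<Rightarrow> ('a \<Rightarrow> real) \<Rightarrow> real"
    and \<F> :: "('a \<Rightarrow> real) set"
    and P :: "real \<Rightarrow> ('a \<Rightarrow> real) \<Rightarrow> 'a \<Rightarrow> real"
    and k :: "real \<Rightarrow> 'a \<Rightarrow> 'a measure"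
    and p :: real
  assumes "dirichlet_space M \<E> \<F>"
    and "heat_semigroup M \<E> \<F> P"
    and "conservative M P"
    and "heat_kernel M P k"
    and "1 < p" and "p \<le> 2"
  shows "(\<exists>C>0. \<forall>f\<in>Lp_space M p. \<forall>t>0.
            besov_seminorm M k p (1/2) (P t f) \<le> ennreal (C / t powr (1/2) * Lp_norm M p f)) \<and>
         (\<forall>t>0. \<exists>K\<ge>0. \<forall>f\<in>Lp_space M p.
            P t f \<in> besov_space M k p (1/2) \<and>
            besov_norm M k p (1/2) (P t f) \<le> K * Lp_norm M p f)"
proof -
  interpret heat_kernel_semigroup M \<E> \<F> P k
    using assms by (intro heat_kernel_semigroup.intro heat_kernel_semigroup_axioms.intro)
  obtain B where B: "0 < B" and bound: "\<And>f s t. f \<in> Lp_space M p \<Longrightarrow> 0 < s \<Longrightarrow> 0 < t \<Longrightarrow>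
    (\<integral>\<^sup>+y. (\<integral>\<^sup>+x. ennreal (\<bar>P t f x - P t f y\<bar> powr p) \<partial>k s y) \<partial>M)
      \<le> ennreal (B * (s / t) powr (p / 2) * Lp_norm M p f powr p)"
    using heat_Besov_integral_bound[OF assms(5,6)] by blast
  define C where "C = B powr (1 / p)"
  have C: "0 < C"
    using B by (simp add: C_def)
  have semi: "besov_seminorm M k p (1/2) (P t f) \<le> ennreal (C / t powr (1/2) * Lp_norm M p f)"
    if f: "f \<in> Lp_space M p" and t: "0 < t" for f t
    unfolding besov_seminorm_def
  proof (rule SUP_least)
    fix s :: real
    assume "s \<in> {0<..}"
    then have s: "0 < s"
      by simp
    have "enn_powr (\<integral>\<^sup>+y. (\<integral>\<^sup>+x. ennreal (\<bar>P t f x - P t f y\<bar> powr p) \<partial>k s y) \<partial>M) (1 / p)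
        \<le> ennreal ((B * (s / t) powr (p / 2) * Lp_norm M p f powr p) powr (1 / p))"
      using assms(5) B by (intro enn_powr_le bound f s t) auto
    also have "(B * (s / t) powr (p / 2) * Lp_norm M p f powr p) powr (1 / p)
        = C * (s / t) powr (1/2) * Lp_norm M p f"
      using assms(5) by (simp add: C_def powr_mult powr_powr)
    finally have "ennreal (s powr - (1/2)) *
        enn_powr (\<integral>\<^sup>+y. (\<integral>\<^sup>+x. ennreal (\<bar>P t f x - P t f y\<bar> powr p) \<partial>k s y) \<partial>M) (1 / p)
      \<le> ennreal (s powr - (1/2)) * ennreal (C * (s / t) powr (1/2) * Lp_norm M p f)"
      by (intro mult_left_mono) auto
    also have "\<dots> = ennreal (s powr - (1/2) * (C * (s / t) powr (1/2) * Lp_norm M p f))"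
      by (rule ennreal_mult'[symmetric]) simp
    \<comment> \<open>The powers of s cancel exactly at the exponent 1/2, so the bound on the
      supremum depends on t alone.\<close>
    also have "s powr - (1/2) * (C * (s / t) powr (1/2) * Lp_norm M p f) = C / t powr (1/2) * Lp_norm M p f"
      using s by (simp add: powr_divide powr_minus field_simps)
    finally show "ennreal (s powr - (1/2)) *
        enn_powr (\<integral>\<^sup>+y. (\<integral>\<^sup>+x. ennreal (\<bar>P t f x - P t f y\<bar> powr p) \<partial>k s y) \<partial>M) (1 / p)
      \<le> ennreal (C / t powr (1/2) * Lp_norm M p f)" .
  qed
  have "P t f \<in> besov_space M k p (1/2) \<and>
      besov_norm M k p (1/2) (P t f) \<le> (1 + C / t powr (1/2)) * Lp_norm M p f"
    if f: "f \<in> Lp_space M p" and t: "0 < t" for f t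
  proof
    have u: "P t f \<in> Lp_space M p" "Lp_norm M p (P t f) \<le> Lp_norm M p f"
      using P_Lp[of p t f] assms(5) t f by auto
    then show "P t f \<in> besov_space M k p (1/2)"
      using semi[OF f t] by (auto simp: besov_space_def intro: le_less_trans)
    have "enn2real (besov_seminorm M k p (1/2) (P t f)) \<le> C / t powr (1/2) * Lp_norm M p f"
      using enn2real_mono[OF semi[OF f t]] C by simp
    then show "besov_norm M k p (1/2) (P t f) \<le> (1 + C / t powr (1/2)) * Lp_norm M p f"
      using u(2) by (simp add: besov_norm_def distrib_right)
  qed
  \<comment> \<open>The summand 1 comes from contraction on L^p, the other from the seminorm bound
    at the fixed time t.\<close>
  then have "\<exists>K\<ge>0. \<forall>f\<in>Lp_space M p. P t f \<in> besov_space M k p (1/2) \<and>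
      besov_norm M k p (1/2) (P t f) \<le> K * Lp_norm M p f" if "0 < t" for t
    using that C by (intro exI[of _ "1 + C / t powr (1/2)"]) auto
  then show ?thesis
    using C semi by blast
qed

end
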